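(* The spectrum of the quadratic pencil satisfies $\sigma(\mathfrak L)\subset\mathbb R$, also when $\Omega\neq0$.
   Context: Fix $\mathsf{G}M_0>0$, $R_0>0$, $\mathsf A>0$, $1<\gamma<2$, $\Omega\in\mathbb R$ and $R$ with $R_0<R$ and $\Omega^2R^3/(2\mathsf{G}M_0)<4/27$. For $\bm x\in\mathbb R^3$ let $r=\|\bm x\|$, $\varpi=\sqrt{(x^1)^2+(x^2)^2}$, $\bar\Upsilon(\bm x)=\mathsf{G}M_0(1/r-1/R)+\frac{\Omega^2}{2}\varpi^2$, $\mathfrak R=\{r>R_0,\ \varpi<3R/2,\ \bar\Upsilon>0\}$, and on $\mathfrak R$: $\bar\rho=(\frac{\gamma-1}{\mathsf A\gamma}\bar\Upsilon)^{1/(\gamma-1)}$, $\bar s=\mathsf A\gamma\bar\rho^{\gamma-2}$. $\mathfrak H=L^2(\mathfrak R,\bar\rho\,d\bm x;\mathbb C^3)$. $\bm L$ is the Friedrichs extension in $\mathfrak H$ of $\bm\xi\mapsto\nabla(-\bar s\,\mathrm{div}(\bar\rho\bm\xi))$ on $C_0^\infty(\mathfrak R;\mathbb C^3)$, with domain $\mathsf D(\bm L)$. $\bm J$ is multiplication by $\begin{bmatrix}0&-1&0\\1&0&0\\0&0&0\end{bmatrix}$, $\bm J_\star=\mathrm i\bm J$. Quadratic pencil: $\mathfrak L(\sigma)=-\sigma^2+2\Omega\sigma\bm J_\star+\bm L$ with domain $\mathsf D(\bm L)$, $\sigma\in\mathbb C$; $\varrho(\mathfrak L)$ is the set of $\sigma$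 for which $\mathfrak L(\sigma)$ has a bounded inverse defined on all of $\mathfrak H$, and $\sigma(\mathfrak L)=\mathbb C\setminus\varrho(\mathfrak L)$. *)

theory Defs
  imports "HOL-Analysis.Analysis"
begin

text \<open>Points of R^3 are of type real^3, vector fields take values in complex^3.
Parameters: GM (= G M_0), R0, A, g (= gamma), Om (= Omega), R.\<close>

type_synonym pt = "real^3"
type_synonym cvec = "complex^3"
type_synonym field = "pt \<Rightarrow> cvec"

definition varpi :: "pt \<Rightarrow> real" where
  "varpi x = sqrt ((x$1)^2 + (x$2)^2)"

definition Ups :: "real \<Rightarrow> real \<Rightarrow> real \<Rightarrow> pt \<Rightarrow> real" where
  "Ups GM Om R x = GM * (1 / norm x - 1 / R) + Om^2 / 2 * (varpi x)^2"

definition region :: "real \<Rightarrow> real \<Rightarrow> real \<Rightarrow> real \<Rightarrow> pt set" where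
  "region GM R0 Om R = {x. norm x > R0 \<and> varpi x < 3 * R / 2 \<and> Ups GM Om R x > 0}"

definition rhobar :: "real \<Rightarrow> real \<Rightarrow> real \<Rightarrow> real \<Rightarrow> real \<Rightarrow> real \<Rightarrow> pt \<Rightarrow> real" where
  "rhobar GM R0 A g Om R x =
     (if x \<in> region GM R0 Om R then ((g - 1) / (A * g) * Ups GM Om R x) powr (1 / (g - 1)) else 0)"

definition sbar :: "real \<Rightarrow> real \<Rightarrow> real \<Rightarrow> real \<Rightarrow> real \<Rightarrow> real \<Rightarrow> pt \<Rightarrow> real" where
  "sbar GM R0 A g Om R x =
     (if x \<in> region GM R0 Om R then A * g * (rhobar GM R0 A g Om R x) powr (g - 2) else 0)"

definition pd :: "3 \<Rightarrow> (pt \<Rightarrow> 'b::real_normed_vector) \<Rightarrow> pt \<Rightarrow> 'b" where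
  "pd i f x = vector_derivative (\<lambda>t. f (x + t *\<^sub>R axis i 1)) (at 0)"

fun pdl :: "3 list \<Rightarrow> (pt \<Rightarrow> 'b::real_normed_vector) \<Rightarrow> pt \<Rightarrow> 'b" where
  "pdl [] f = f"
| "pdl (i # is) f = pd i (pdl is f)"

definition smooth :: "(pt \<Rightarrow> 'b::real_normed_vector) \<Rightarrow> bool" where
  "smooth f \<longleftrightarrow> (\<forall>is. continuous_on UNIV (pdl is f) \<and>
      (\<forall>i x. (\<lambda>t. pdl is f (x + t *\<^sub>R axis i 1)) differentiable (at 0)))"

definition tsupp :: "(pt \<Rightarrow> cvec) \<Rightarrow> pt set" where
  "tsupp f = closure {x. f x \<noteq> 0}"

definition C0inf :: "pt set \<Rightarrow> field set" where
  "C0inf U = {\<phi>. smooth \<phi> \<and> compact (tsupp \<phi>) \<and> tsupp \<phi> \<subseteq> U}"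

definition cinner :: "cvec \<Rightarrow> cvec \<Rightarrow> complex" where
  "cinner u v = (\<Sum>i\<in>UNIV. u$i * cnj (v$i))"

text \<open>The Hilbert space L^2(U, w dx; C^3) (functions, equality almost everywhere).\<close>
definition Hsp :: "pt set \<Rightarrow> (pt \<Rightarrow> real) \<Rightarrow> field set" where
  "Hsp U w = {\<xi>. \<xi> \<in> borel_measurable lborel \<and>
                   set_integrable lborel U (\<lambda>x. w x * (norm (\<xi> x))^2)}"

definition Hinner :: "pt set \<Rightarrow> (pt \<Rightarrow> real) \<Rightarrow> field \<Rightarrow> field \<Rightarrow> complex" where
  "Hinner U w \<xi> \<eta> = (LINT x:U|lborel. complex_of_real (w x) * cinner (\<xi> x) (\<eta> x))"

definition Hnorm :: "pt set \<Rightarrow> (pt \<Rightarrow> real) \<Rightarrow> field \<Rightarrow> real" where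
  "Hnorm U w \<xi> = sqrt (LINT x:U|lborel. w x * (norm (\<xi> x))^2)"

definition Heq :: "pt set \<Rightarrow> field \<Rightarrow> field \<Rightarrow> bool" where
  "Heq U \<xi> \<eta> \<longleftrightarrow> (AE x in lborel. x \<in> U \<longrightarrow> \<xi> x = \<eta> x)"

definition Aop :: "(pt \<Rightarrow> real) \<Rightarrow> (pt \<Rightarrow> real) \<Rightarrow> field \<Rightarrow> field" where
  "Aop rho s \<xi> = (let d = (\<lambda>y. \<Sum>i\<in>UNIV. pd i (\<lambda>z. complex_of_real (rho z) * \<xi> z $ i) y);
                       q = (\<lambda>y. - complex_of_real (s y) * d y)
                   in (\<lambda>x. \<chi> j. pd j q x))"

text \<open>Form domain of the Friedrichs extension: closure of C_0^infinity in the form norm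
  (a(phi,phi) + ||phi||^2)^(1/2), where a(phi,psi) = <A phi, psi>_H.\<close>
definition formdom :: "pt set \<Rightarrow> (pt \<Rightarrow> real) \<Rightarrow> (pt \<Rightarrow> real) \<Rightarrow> field set" where
  "formdom U rho s = {\<xi>. \<xi> \<in> Hsp U rho \<and>
     (\<exists>\<phi>::nat \<Rightarrow> field. (\<forall>n. \<phi> n \<in> C0inf U) \<and>
        (\<lambda>n. Hnorm U rho (\<lambda>x. \<phi> n x - \<xi> x)) \<longlonglongrightarrow> 0 \<and>
        (\<forall>e>0. \<exists>N. \<forall>m\<ge>N. \<forall>n\<ge>N.
            Re (Hinner U rho (Aop rho s (\<lambda>x. \<phi> n x - \<phi> m x)) (\<lambda>x. \<phi> n x - \<phi> m x)) < e))}"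

text \<open>Graph of the Friedrichs extension L: xi in D(L) and L xi = f iff xi lies in the form
  domain and a(xi, psi) = <f, psi>_H for all psi in the form core C_0^infinity, where the
  closed form is a(xi, psi) = <xi, A psi>_H (continuous extension).\<close>
definition Lgraph :: "pt set \<Rightarrow> (pt \<Rightarrow> real) \<Rightarrow> (pt \<Rightarrow> real) \<Rightarrow> field \<Rightarrow> field \<Rightarrow> bool" where
  "Lgraph U rho s \<xi> f \<longleftrightarrow> \<xi> \<in> formdom U rho s \<and> f \<in> Hsp U rho \<and>
     (\<forall>\<psi>\<in>C0inf U. Hinner U rho \<xi> (Aop rho s \<psi>) = Hinner U rho f \<psi>)"

definition csc :: "complex \<Rightarrow> cvec \<Rightarrow> cvec" where
  "csc c v = (\<chi> j. c * v$j)"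

definition Jstar :: "cvec \<Rightarrow> cvec" where
  "Jstar v = (\<chi> j. \<i> * (if j = 1 then - v$2 else if j = 2 then v$1 else 0))"

text \<open>Resolvent set of the pencil -sigma^2 + 2 Omega sigma J_star + L on D(L):
  the operator is onto H and has a bounded inverse.\<close>
definition pencil_resolvent :: "real \<Rightarrow> real \<Rightarrow> real \<Rightarrow> real \<Rightarrow> real \<Rightarrow> real \<Rightarrow> complex set" where
  "pencil_resolvent GM R0 A g Om R =
    (let U = region GM R0 Om R; rho = rhobar GM R0 A g Om R; s = sbar GM R0 A g Om R;
         P = (\<lambda>\<sigma> \<xi> f x. csc (- (\<sigma>^2)) (\<xi> x) + csc (2 * complex_of_real Om * \<sigma>) (Jstar (\<xi> x)) + f x)
     in {\<sigma>. (\<forall>h\<in>Hsp U rho. \<exists>\<xi> f. Lgraph U rho s \<xi> f \<and> Heq U (P \<sigma> \<xi> f) h) \<and>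
            (\<exists>C. \<forall>\<xi> f. Lgraph U rho s \<xi> f \<longrightarrow> Hnorm U rho \<xi> \<le> C * Hnorm U rho (P \<sigma> \<xi> f))})"

definition pencil_spectrum :: "real \<Rightarrow> real \<Rightarrow> real \<Rightarrow> real \<Rightarrow> real \<Rightarrow> real \<Rightarrow> complex set" where
  "pencil_spectrum GM R0 A g Om R = UNIV - pencil_resolvent GM R0 A g Om R"

end

theory Submission
  imports Defs
begin

text \<open>Write \<open>B(\<xi>,\<eta>)\<close> for the form of the pencil at \<open>\<sigma>\<close>. Since \<open>L\<close> is symmetric and
  non-negative and \<open>J\<^sub>\<star>\<close> is symmetric, the imaginary part of \<open>B(\<xi>,\<xi>) / \<sigma>\<close> is
  \<open>- Im \<sigma> (\<parallel>\<xi>\<parallel>\<^sup>2 + \<langle>L\<xi>,\<xi>\<rangle> / |\<sigma>|\<^sup>2)\<close>, whatever \<open>\<Omega>\<close> is. So for \<open>Im \<sigma> \<noteq> 0\<close> a scalar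
  multiple of \<open>B\<close> is coercive on the form domain; the Lax-Milgram theorem gives surjectivity and the
  same estimate gives the bound of the inverse. Instead of completing \<open>C\<^sub>0\<^sup>\<infinity>\<close> in the energy norm,
  the equation is solved approximately inside \<open>C\<^sub>0\<^sup>\<infinity>\<close> (Richardson iteration with approximate Riesz
  representatives); by coercivity the approximate solutions form a Cauchy sequence, whose
  limit in \<open>L\<^sup>2\<close> lies in the form domain and solves the weak equation.\<close>

section \<open>Approximate Lax-Milgram theorem without completeness\<close>

text \<open>Why the rotation is harmless: multiplied by \<open>cnj \<sigma>\<close>, its
  contribution becomes \<open>2 * Om * |\<sigma>|^2\<close> times the real number
  \<open><J\<^sub>\<star>\<xi>,\<xi>>\<close> and drops out of the imaginary part, while the two
  remaining contributions keep the same sign. The obstacle is the form domain. It is given by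
  sequences of test fields that are Cauchy in energy and converge in \<open>L^2\<close>, not as a
  Hilbert space; an abstract completion would have to be identified with a subspace of
  \<open>L^2\<close> before it could be used. Approximate solutions in \<open>C0inf\<close> avoid
  this: their Cauchy property is literally the membership condition of \<open>formdom\<close>. Since
  the weak equation in \<open>Lgraph\<close> puts the operator on the test field, \<open>L^2\<close>
  convergence alone passes it to the limit. Hence the only complete space used is
  \<open>L^2\<close>. The weight of the energy form and the complex factor in front of the pencil
  are matched so that coercivity holds with constant exactly 1.\<close>

lemma quadratic_form_bound:
  fixes z :: complex and n D :: real
  assumes bd: "\<And>c. 2 * Re (cnj c * z) - (cmod c)\<^sup>2 * n \<le> D" and n: "n \<ge> 0"
  shows "(cmod z)\<^sup>2 \<le> D * n"
proof -
  \<comment> \<open>The hypothesis is exploited only for \<open>c\<close> on the real line through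
    \<open>z\<close>. This optimisation is the common core of Cauchy-Schwarz, of the approximate
    Riesz theorem and of the dual norm estimate.\<close>
  have Re: "Re (cnj (of_real t * z) * z) = t * (cmod z)\<^sup>2" for t
    unfolding cmod_power2 by (simp add: power2_eq_square algebra_simps)
  show ?thesis
  proof (cases "n = 0")
    case True
    \<comment> \<open>Without a quadratic term the left side is linear in \<open>t\<close>, hence
      unbounded unless \<open>z = 0\<close>; the value of \<open>t\<close> chosen below would give
      \<open>D + 1 \<le> D\<close>.\<close>
    have "2 * (t * (cmod z)\<^sup>2) \<le> D" for t
      using bd[of "of_real t * z", unfolded Re] True by simp
    from this[of "(D + 1) / (2 * (cmod z)\<^sup>2)"] have "z = 0" by (cases "z = 0") auto
    then show ?thesis using True by simp
  next
    case False
    then have n: "n > 0" using n by simp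
    \<comment> \<open>The maximiser of the left side is \<open>c = z / n\<close>.\<close>
    then have "2 * (1 / n * (cmod z)\<^sup>2) - (cmod z)\<^sup>2 / n \<le> D"
      using bd[of "of_real (1 / n) * z", unfolded Re]
      by (simp add: norm_divide power2_eq_square)
    then show ?thesis using n by (simp add: field_simps)
  qed
qed

text \<open>The vector space structure on the carrier is encoded by the single operation
  \<open>lc \<phi> c \<psi> = \<phi> + c \<psi>\<close>; the form may be degenerate, so that functions need not be
  identified almost everywhere.\<close>

locale semi_inner_space =
  fixes E :: "'a set" and lc :: "'a \<Rightarrow> complex \<Rightarrow> 'a \<Rightarrow> 'a" and G :: "'a \<Rightarrow> 'a \<Rightarrow> complex"
  assumes nonempty: "E \<noteq> {}"
    and lc_in: "\<lbrakk>\<phi> \<in> E; \<psi> \<in> E\<rbrakk> \<Longrightarrow> lc \<phi> c \<psi> \<in> E"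
    and G_left: "\<lbrakk>\<phi> \<in> E; \<psi> \<in> E; \<theta> \<in> E\<rbrakk> \<Longrightarrow> G (lc \<phi> c \<psi>) \<theta> = G \<phi> \<theta> + c * G \<psi> \<theta>"
    and G_herm: "\<lbrakk>\<phi> \<in> E; \<psi> \<in> E\<rbrakk> \<Longrightarrow> G \<phi> \<psi> = cnj (G \<psi> \<phi>)"
    and G_nonneg: "\<phi> \<in> E \<Longrightarrow> 0 \<le> Re (G \<phi> \<phi>)"
begin

definition nrm :: "'a \<Rightarrow> real" where
  "nrm \<phi> = sqrt (Re (G \<phi> \<phi>))"

lemma nrm_nonneg: "\<phi> \<in> E \<Longrightarrow> 0 \<le> nrm \<phi>"
  by (simp add: nrm_def G_nonneg)

lemma nrm_sq: "\<phi> \<in> E \<Longrightarrow> (nrm \<phi>)\<^sup>2 = Re (G \<phi> \<phi>)"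
  by (simp add: nrm_def G_nonneg)

lemma G_self: "\<phi> \<in> E \<Longrightarrow> G \<phi> \<phi> = of_real ((nrm \<phi>)\<^sup>2)"
  using G_herm[of \<phi> \<phi>] by (simp add: nrm_sq complex_eq_iff)

lemma G_right:
  assumes "\<phi> \<in> E" "\<psi> \<in> E" "\<theta> \<in> E"
  shows "G \<theta> (lc \<phi> c \<psi>) = G \<theta> \<phi> + cnj c * G \<theta> \<psi>"
  using assms G_herm[of \<theta> "lc \<phi> c \<psi>"] G_herm[of \<theta> \<phi>] G_herm[of \<theta> \<psi>]
  by (simp add: lc_in G_left)

lemma nrm_lc:
  assumes "\<phi> \<in> E" "\<psi> \<in> E"
  shows "(nrm (lc \<phi> c \<psi>))\<^sup>2 = (nrm \<phi>)\<^sup>2 + 2 * Re (cnj c * G \<phi> \<psi>) + (cmod c)\<^sup>2 * (nrm \<psi>)\<^sup>2"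
proof -
  have "G (lc \<phi> c \<psi>) (lc \<phi> c \<psi>) =
      G \<phi> \<phi> + cnj c * G \<phi> \<psi> + c * G \<psi> \<phi> + (c * cnj c) * G \<psi> \<psi>"
    using assms by (simp add: lc_in G_left G_right algebra_simps)
  also have "c * G \<psi> \<phi> = cnj (cnj c * G \<phi> \<psi>)" using assms G_herm[of \<phi> \<psi>] by simp
  also have "c * cnj c = of_real ((cmod c)\<^sup>2)" by (simp only: complex_norm_square)
  finally show ?thesis using assms by (simp add: lc_in nrm_sq)
qed

text \<open>Optimising over all \<open>c\<close> instead of dividing by \<open>nrm \<psi>\<close>
  covers vectors of norm zero as well, which a degenerate form has.\<close>

lemma Cauchy_Schwarz:
  assumes "\<phi> \<in> E" "\<psi> \<in> E"
  shows "cmod (G \<phi> \<psi>) \<le> nrm \<phi> * nrm \<psi>"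
proof -
  have "(cmod (G \<phi> \<psi>))\<^sup>2 \<le> (nrm \<phi>)\<^sup>2 * (nrm \<psi>)\<^sup>2"
  proof (rule quadratic_form_bound)
    fix c
    have "0 \<le> (nrm (lc \<phi> (-c) \<psi>))\<^sup>2" by simp
    then show "2 * Re (cnj c * G \<phi> \<psi>) - (cmod c)\<^sup>2 * (nrm \<psi>)\<^sup>2 \<le> (nrm \<phi>)\<^sup>2"
      using assms by (subst (asm) nrm_lc) auto
  qed simp
  then have "(cmod (G \<phi> \<psi>))\<^sup>2 \<le> (nrm \<phi> * nrm \<psi>)\<^sup>2" by (simp add: power_mult_distrib)
  then show ?thesis using assms nrm_nonneg by (meson mult_nonneg_nonneg power2_le_imp_le)
qed

lemma nrm_triangle:
  assumes "\<phi> \<in> E" "\<psi> \<in> E"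
  shows "nrm (lc \<phi> c \<psi>) \<le> nrm \<phi> + cmod c * nrm \<psi>"
proof (rule power2_le_imp_le)
  have "Re (cnj c * G \<phi> \<psi>) \<le> cmod (cnj c * G \<phi> \<psi>)" by (rule complex_Re_le_cmod)
  also have "\<dots> \<le> cmod c * (nrm \<phi> * nrm \<psi>)"
    using Cauchy_Schwarz[OF assms] by (simp add: norm_mult mult_left_mono)
  finally show "(nrm (lc \<phi> c \<psi>))\<^sup>2 \<le> (nrm \<phi> + cmod c * nrm \<psi>)\<^sup>2"
    using assms by (simp add: nrm_lc power2_sum power_mult_distrib algebra_simps)
qed (use assms nrm_nonneg in auto)

definition antilinear :: "('a \<Rightarrow> complex) \<Rightarrow> bool" where
  "antilinear l \<longleftrightarrow> (\<forall>\<phi>\<in>E. \<forall>\<psi>\<in>E. \<forall>c. l (lc \<phi> c \<psi>) = l \<phi> + cnj c * l \<psi>)"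

text \<open>Without completeness a bounded functional is represented only up to a small error: almost
  minimise the quadratic functional \<open>\<parallel>\<phi>\<parallel>\<^sup>2 - 2 Re (l \<phi>)\<close>.\<close>

lemma approximate_Riesz:
  assumes l: "antilinear l" and K: "\<And>\<psi>. \<psi> \<in> E \<Longrightarrow> cmod (l \<psi>) \<le> K * nrm \<psi>" and e: "e > 0"
  obtains \<eta> where "\<eta> \<in> E" "\<And>\<psi>. \<psi> \<in> E \<Longrightarrow> cmod (G \<eta> \<psi> - l \<psi>) \<le> e * nrm \<psi>"
proof -
  define Q where "Q \<phi> = (nrm \<phi>)\<^sup>2 - 2 * Re (l \<phi>)" for \<phi>
  \<comment> \<open>Completing the square: \<open>t^2 - 2 * K * t \<ge> - K^2\<close> with
    \<open>t = nrm \<phi>\<close>.\<close>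
  have low: "- K\<^sup>2 \<le> Q \<phi>" if "\<phi> \<in> E" for \<phi>
  proof -
    have "Re (l \<phi>) \<le> K * nrm \<phi>" using K[OF that] complex_Re_le_cmod order_trans by blast
    moreover have "0 \<le> (nrm \<phi> - K)\<^sup>2" by simp
    ultimately show ?thesis unfolding Q_def power2_diff by (simp add: algebra_simps)
  qed
  then have bdd: "bdd_below (Q ` E)" by (auto intro!: bdd_belowI2)
  \<comment> \<open>A defect \<open>e^2\<close> in the minimum costs \<open>e\<close> in the
    representation: minimality up to \<open>e^2\<close> under all variations
    \<open>\<eta> - c \<psi>\<close> is the hypothesis of \<open>quadratic_form_bound\<close> with
    \<open>D = e^2\<close>.\<close>
  have "Inf (Q ` E) < Inf (Q ` E) + e\<^sup>2" using e by simp
  then obtain \<eta> where \<eta>: "\<eta> \<in> E" "Q \<eta> < Inf (Q ` E) + e\<^sup>2"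
    using cInf_lessD[of "Q ` E"] nonempty by blast
  show ?thesis
  proof (rule that[OF \<eta>(1)])
    fix \<psi> assume \<psi>: "\<psi> \<in> E"
    have "(cmod (G \<eta> \<psi> - l \<psi>))\<^sup>2 \<le> e\<^sup>2 * (nrm \<psi>)\<^sup>2"
    proof (rule quadratic_form_bound)
      fix c
      have "Inf (Q ` E) \<le> Q (lc \<eta> (-c) \<psi>)"
        using bdd \<eta> \<psi> by (intro cInf_lower) (auto simp: lc_in)
      then have "Q \<eta> - e\<^sup>2 \<le> Q (lc \<eta> (-c) \<psi>)" using \<eta>(2) by simp
      moreover have "l (lc \<eta> (-c) \<psi>) = l \<eta> - cnj c * l \<psi>"
        using l \<eta> \<psi> by (simp add: antilinear_def)
      ultimately show "2 * Re (cnj c * (G \<eta> \<psi> - l \<psi>)) - (cmod c)\<^sup>2 * (nrm \<psi>)\<^sup>2 \<le> e\<^sup>2"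
        using \<eta> \<psi> by (simp add: Q_def nrm_lc algebra_simps)
    qed simp
    then have "(cmod (G \<eta> \<psi> - l \<psi>))\<^sup>2 \<le> (e * nrm \<psi>)\<^sup>2" by (simp add: power_mult_distrib)
    then show "cmod (G \<eta> \<psi> - l \<psi>) \<le> e * nrm \<psi>"
      using e nrm_nonneg[OF \<psi>] by (meson less_imp_le mult_nonneg_nonneg power2_le_imp_le)
  qed
qed

text \<open>The expansion of the squared dual norm of \<open>G \<eta> - b\<close>, with \<open>K\<close> a bound for the
  dual norm of \<open>b\<close>.\<close>

lemma dual_norm_diff:
  assumes b: "antilinear b" and K: "\<And>\<psi>. \<psi> \<in> E \<Longrightarrow> cmod (b \<psi>) \<le> K * nrm \<psi>"
    and \<eta>: "\<eta> \<in> E" and \<psi>: "\<psi> \<in> E"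
  shows "(cmod (G \<eta> \<psi> - b \<psi>))\<^sup>2 \<le> ((nrm \<eta>)\<^sup>2 - 2 * Re (b \<eta>) + K\<^sup>2) * (nrm \<psi>)\<^sup>2"
proof (rule quadratic_form_bound)
  fix c
  let ?w = "lc \<eta> (-c) \<psi>"
  have w: "?w \<in> E" using \<eta> \<psi> by (rule lc_in)
  have "Re (b ?w) \<le> K * nrm ?w" using K[OF w] complex_Re_le_cmod order_trans by blast
  moreover have "0 \<le> (nrm ?w - K)\<^sup>2" by simp
  ultimately have "2 * Re (b ?w) \<le> (nrm ?w)\<^sup>2 + K\<^sup>2" unfolding power2_diff by (simp add: algebra_simps)
  moreover have "b ?w = b \<eta> - cnj c * b \<psi>" using b \<eta> \<psi> by (simp add: antilinear_def)
  ultimately show "2 * Re (cnj c * (G \<eta> \<psi> - b \<psi>)) - (cmod c)\<^sup>2 * (nrm \<psi>)\<^sup>2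
      \<le> (nrm \<eta>)\<^sup>2 - 2 * Re (b \<eta>) + K\<^sup>2"
    using \<eta> \<psi> by (simp add: nrm_lc algebra_simps)
qed simp

text \<open>Let \<open>\<eta>\<close> represent the residual \<open>l - B \<phi>\<close> up to a
  small error and replace \<open>\<phi>\<close> by \<open>\<phi> + \<tau> \<eta>\<close>. Up to that
  error the new residual is \<open>G \<eta> - \<tau> B \<eta>\<close>, whose squared dual norm is at
  most \<open>(1 - 2 \<tau> + \<tau>^2 M^2)\<close> times the squared norm of \<open>\<eta>\<close>,
  by coercivity and boundedness. So residuals contract, and finitely many steps suffice for any
  tolerance.\<close>

lemma approximate_Lax_Milgram:
  assumes l: "antilinear l" and K: "\<And>\<psi>. \<psi> \<in> E \<Longrightarrow> cmod (l \<psi>) \<le> K * nrm \<psi>"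
    and B1: "\<And>\<phi> \<psi> \<theta> c. \<lbrakk>\<phi> \<in> E; \<psi> \<in> E; \<theta> \<in> E\<rbrakk> \<Longrightarrow> B (lc \<phi> c \<psi>) \<theta> = B \<phi> \<theta> + c * B \<psi> \<theta>"
    and B2: "\<And>\<phi>. \<phi> \<in> E \<Longrightarrow> antilinear (B \<phi>)"
    and M: "\<And>\<phi> \<psi>. \<lbrakk>\<phi> \<in> E; \<psi> \<in> E\<rbrakk> \<Longrightarrow> cmod (B \<phi> \<psi>) \<le> M * nrm \<phi> * nrm \<psi>"
    and co: "\<And>\<phi>. \<phi> \<in> E \<Longrightarrow> (nrm \<phi>)\<^sup>2 \<le> Re (B \<phi> \<phi>)"
    and e: "e > 0"
  obtains \<eta> where "\<eta> \<in> E" "\<And>\<psi>. \<psi> \<in> E \<Longrightarrow> cmod (B \<eta> \<psi> - l \<psi>) \<le> e * nrm \<psi>"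
proof -
  \<comment> \<open>A bound of at least 1 keeps \<open>1 - 1 / M'^2\<close> nonnegative, so that its
    root is a contraction factor.\<close>
  define M' where "M' = max M 1"
  have M'1: "M' \<ge> 1" by (simp add: M'_def)
  have M': "cmod (B \<phi> \<psi>) \<le> M' * nrm \<phi> * nrm \<psi>" if "\<phi> \<in> E" "\<psi> \<in> E" for \<phi> \<psi>
  proof -
    have "M * nrm \<phi> * nrm \<psi> \<le> M' * nrm \<phi> * nrm \<psi>"
      using that nrm_nonneg by (simp add: M'_def mult_right_mono)
    then show ?thesis using M[OF that] by simp
  qed
  \<comment> \<open>The minimiser of \<open>1 - 2 \<tau> + \<tau>^2 M'^2\<close>; the minimum is the
    square of \<open>k\<close>.\<close>
  define \<tau> where "\<tau> = 1 / M'\<^sup>2"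
  define k where "k = sqrt (1 - 1 / M'\<^sup>2)"
  have k: "0 \<le> k" "k < 1" using M'1 by (auto simp: k_def)
  have ksq: "k\<^sup>2 = 1 - 2 * \<tau> + (\<tau> * M')\<^sup>2"
  proof -
    have "k\<^sup>2 = 1 - 1 / M'\<^sup>2" using M'1 by (simp add: k_def)
    then show ?thesis using M'1 by (simp add: \<tau>_def power2_eq_square field_simps)
  qed
  have \<tau>: "\<tau> > 0" using M'1 by (simp add: \<tau>_def)
  \<comment> \<open>Halfway between \<open>k\<close> and 1, leaving room for the Riesz error: with
    \<open>\<epsilon> = (1 - k) / 4 * N\<close> one has
    \<open>k * N + 2 * \<epsilon> = q * N\<close>.\<close>
  define q where "q = (1 + k) / 2"
  have q: "0 < q" "q < 1" using k by (auto simp: q_def)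
  define K' where "K' = max K 1"
  have step: "\<exists>\<phi>'\<in>E. \<forall>\<psi>\<in>E. cmod (l \<psi> - B \<phi>' \<psi>) \<le> (q * N) * nrm \<psi>"
    if \<phi>: "\<phi> \<in> E" and N: "N > 0" "\<And>\<psi>. \<psi> \<in> E \<Longrightarrow> cmod (l \<psi> - B \<phi> \<psi>) \<le> N * nrm \<psi>" for \<phi> N
  proof -
    define \<epsilon> where "\<epsilon> = (1 - k) / 4 * N"
    have \<epsilon>: "\<epsilon> > 0" using N k by (simp add: \<epsilon>_def)
    have "antilinear (\<lambda>\<psi>. l \<psi> - B \<phi> \<psi>)"
      using l B2[OF \<phi>] by (simp add: antilinear_def algebra_simps)
    from approximate_Riesz[OF this N(2) \<epsilon>]
    obtain \<eta> where \<eta>: "\<eta> \<in> E"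
      and ap: "\<And>\<psi>. \<psi> \<in> E \<Longrightarrow> cmod (G \<eta> \<psi> - (l \<psi> - B \<phi> \<psi>)) \<le> \<epsilon> * nrm \<psi>" by blast
    \<comment> \<open>Testing the approximate representation with \<open>\<eta>\<close> itself
      bounds its norm by that of the residual, up to \<open>\<epsilon>\<close>.\<close>
    have n\<eta>: "nrm \<eta> \<le> N + \<epsilon>"
    proof -
      have "cmod (G \<eta> \<eta>) \<le> cmod (G \<eta> \<eta> - (l \<eta> - B \<phi> \<eta>)) + cmod (l \<eta> - B \<phi> \<eta>)"
        by norm
      also have "\<dots> \<le> (N + \<epsilon>) * nrm \<eta>" using ap[OF \<eta>] N(2)[OF \<eta>] by (simp add: algebra_simps)
      finally have "nrm \<eta> * nrm \<eta> \<le> (N + \<epsilon>) * nrm \<eta>"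
        using \<eta> by (simp add: G_self power2_eq_square norm_mult nrm_nonneg)
      then show ?thesis using nrm_nonneg[OF \<eta>] N \<epsilon> by (cases "nrm \<eta> = 0") auto
    qed
    have main: "cmod (G \<eta> \<psi> - \<tau> * B \<eta> \<psi>) \<le> k * nrm \<eta> * nrm \<psi>" if \<psi>: "\<psi> \<in> E" for \<psi>
    proof -
      \<comment> \<open>The dual norm expansion for \<open>b = \<tau> B \<eta>\<close>: boundedness
        of \<open>B\<close> supplies its dual norm, and coercivity is then used on the cross
        term.\<close>
      have "(cmod (G \<eta> \<psi> - \<tau> * B \<eta> \<psi>))\<^sup>2
          \<le> ((nrm \<eta>)\<^sup>2 - 2 * Re (\<tau> * B \<eta> \<eta>) + (\<tau> * M' * nrm \<eta>)\<^sup>2) * (nrm \<psi>)\<^sup>2"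
      proof (rule dual_norm_diff[OF _ _ \<eta> \<psi>])
        show "antilinear (\<lambda>\<psi>. \<tau> * B \<eta> \<psi>)" using B2[OF \<eta>] by (simp add: antilinear_def algebra_simps)
        fix \<theta> assume "\<theta> \<in> E"
        then show "cmod (\<tau> * B \<eta> \<theta>) \<le> \<tau> * M' * nrm \<eta> * nrm \<theta>"
          using M'[OF \<eta>, of \<theta>] \<tau> by (simp add: norm_mult mult.assoc)
      qed
      also have "\<dots> \<le> ((nrm \<eta>)\<^sup>2 - 2 * \<tau> * (nrm \<eta>)\<^sup>2 + (\<tau> * M' * nrm \<eta>)\<^sup>2) * (nrm \<psi>)\<^sup>2"
        using co[OF \<eta>] \<tau> by (intro mult_right_mono) auto
      also have "\<dots> = (k * nrm \<eta> * nrm \<psi>)\<^sup>2"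
        unfolding power_mult_distrib ksq by (simp add: algebra_simps)
      finally show ?thesis using k nrm_nonneg \<eta> \<psi> by (meson mult_nonneg_nonneg power2_le_imp_le)
    qed
    show ?thesis
    proof (rule bexI[of _ "lc \<phi> (of_real \<tau>) \<eta>"], rule ballI)
      fix \<psi> assume \<psi>: "\<psi> \<in> E"
      have "cmod (l \<psi> - B (lc \<phi> (of_real \<tau>) \<eta>) \<psi>)
          = cmod ((G \<eta> \<psi> - \<tau> * B \<eta> \<psi>) - (G \<eta> \<psi> - (l \<psi> - B \<phi> \<psi>)))"
        using \<phi> \<eta> \<psi> by (simp add: B1 algebra_simps)
      also have "\<dots> \<le> cmod (G \<eta> \<psi> - \<tau> * B \<eta> \<psi>) + cmod (G \<eta> \<psi> - (l \<psi> - B \<phi> \<psi>))"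
        by (rule norm_triangle_ineq4)
      also have "\<dots> \<le> (k * nrm \<eta> + \<epsilon>) * nrm \<psi>"
        using main[OF \<psi>] ap[OF \<psi>] by (simp add: algebra_simps)
      also have "\<dots> \<le> (q * N) * nrm \<psi>"
      proof (rule mult_right_mono)
        have "k * nrm \<eta> + \<epsilon> \<le> k * (N + \<epsilon>) + \<epsilon>" using n\<eta> k by (simp add: mult_left_mono)
        also have "\<dots> \<le> k * N + 2 * \<epsilon>"
          using k \<epsilon> mult_right_mono[of k 1 \<epsilon>] by (simp add: algebra_simps)
        also have "\<dots> = q * N" by (simp add: \<epsilon>_def q_def field_simps)
        finally show "k * nrm \<eta> + \<epsilon> \<le> q * N" .
      qed (rule nrm_nonneg[OF \<psi>])
      finally show "cmod (l \<psi> - B (lc \<phi> (of_real \<tau>) \<eta>) \<psi>) \<le> (q * N) * nrm \<psi>" .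
    qed (rule lc_in[OF \<phi> \<eta>])
  qed
  obtain \<phi>0 where \<phi>0: "\<phi>0 \<in> E" using nonempty by blast
  \<comment> \<open>Bounds the residual of an arbitrary starting vector; the summand 1 makes it
    strictly positive, as the contraction step requires.\<close>
  define N0 where "N0 = \<bar>K\<bar> + M' * nrm \<phi>0 + 1"
  have N0: "N0 > 0" using M'1 nrm_nonneg[OF \<phi>0] by (simp add: N0_def add_nonneg_pos)
  have it: "\<exists>\<phi>\<in>E. \<forall>\<psi>\<in>E. cmod (l \<psi> - B \<phi> \<psi>) \<le> (q ^ n * N0) * nrm \<psi>" for n
  proof (induction n)
    case 0
    show ?case
    proof (rule bexI[OF _ \<phi>0], rule ballI)
      fix \<psi> assume \<psi>: "\<psi> \<in> E"
      have "cmod (l \<psi> - B \<phi>0 \<psi>) \<le> K * nrm \<psi> + M' * nrm \<phi>0 * nrm \<psi>"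
        using norm_triangle_ineq4[of "l \<psi>" "B \<phi>0 \<psi>"] K[OF \<psi>] M'[OF \<phi>0 \<psi>] by linarith
      also have "\<dots> = (K + M' * nrm \<phi>0) * nrm \<psi>" by (simp add: algebra_simps)
      also have "\<dots> \<le> N0 * nrm \<psi>" 
        using nrm_nonneg[OF \<psi>] by (intro mult_right_mono) (auto simp: N0_def)
      finally show "cmod (l \<psi> - B \<phi>0 \<psi>) \<le> (q ^ 0 * N0) * nrm \<psi>" by simp
    qed
  next
    case (Suc n)
    then obtain \<phi> where "\<phi> \<in> E" "\<And>\<psi>. \<psi> \<in> E \<Longrightarrow> cmod (l \<psi> - B \<phi> \<psi>) \<le> (q ^ n * N0) * nrm \<psi>" by blast
    from step[OF this(1) _ this(2)] show ?case using q N0 by (simp add: mult.assoc)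
  qed
  have "(\<lambda>n. q ^ n * N0) \<longlonglongrightarrow> 0 * N0"
    using q by (intro tendsto_mult LIMSEQ_power_zero) auto
  then have "eventually (\<lambda>n. q ^ n * N0 < e) sequentially" using e by (auto intro: order_tendstoD)
  then obtain n where n: "q ^ n * N0 < e" by (auto simp: eventually_sequentially)
  from it[of n] obtain \<phi> where \<phi>: "\<phi> \<in> E"
    and r: "\<And>\<psi>. \<psi> \<in> E \<Longrightarrow> cmod (l \<psi> - B \<phi> \<psi>) \<le> (q ^ n * N0) * nrm \<psi>" by blast
  show ?thesis
  proof (rule that[OF \<phi>])
    fix \<psi> assume \<psi>: "\<psi> \<in> E"
    have "cmod (B \<phi> \<psi> - l \<psi>) \<le> (q ^ n * N0) * nrm \<psi>" using r[OF \<psi>] by (simp add: norm_minus_commute)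
    also have "\<dots> \<le> e * nrm \<psi>" using n nrm_nonneg[OF \<psi>] by (intro mult_right_mono) auto
    finally show "cmod (B \<phi> \<psi> - l \<psi>) \<le> e * nrm \<psi>" .
  qed
qed

end

section \<open>The weighted space of square integrable fields\<close>

lemma cinner_add_left: "cinner (u + v) w = cinner u w + cinner v w"
  by (simp add: cinner_def sum.distrib algebra_simps)

lemma cinner_csc_left: "cinner (csc c u) w = c * cinner u w"
  by (simp add: cinner_def csc_def sum_distrib_left mult.assoc)

lemma cnj_cinner: "cnj (cinner u v) = cinner v u"
  by (simp add: cinner_def mult.commute)

lemma cinner_self: "cinner u u = of_real ((norm u)\<^sup>2)"
  by (simp add: cinner_def norm_vec_def L2_set_def sum_nonneg complex_norm_square del: of_real_power)

lemma cmod_cinner_le: "cmod (cinner u v) \<le> ((norm u)\<^sup>2 + (norm v)\<^sup>2) / 2"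
proof -
  have "cmod (cinner u v) \<le> (\<Sum>i\<in>UNIV. cmod (u$i) * cmod (v$i))"
    unfolding cinner_def by (rule order_trans[OF norm_sum]) (simp add: norm_mult)
  also have "\<dots> \<le> (\<Sum>i\<in>UNIV. ((cmod (u$i))\<^sup>2 + (cmod (v$i))\<^sup>2) / 2)"
  proof (rule sum_mono)
    show "cmod (u$i) * cmod (v$i) \<le> ((cmod (u$i))\<^sup>2 + (cmod (v$i))\<^sup>2) / 2" for i
      using sum_squares_bound[of "cmod (u$i)" "cmod (v$i)"] by simp
  qed
  also have "\<dots> = ((norm u)\<^sup>2 + (norm v)\<^sup>2) / 2"
    by (simp add: norm_vec_def L2_set_def sum_nonneg sum.distrib flip: sum_divide_distrib)
  finally show ?thesis .
qed

lemma norm_csc: "norm (csc c u) = cmod c * norm u"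
  by (simp add: csc_def norm_vec_def L2_set_def norm_mult power_mult_distrib
      real_sqrt_mult flip: sum_distrib_left)

lemma norm_Jstar_le: "norm (Jstar u) \<le> norm u"
  by (auto simp: Jstar_def norm_vec_def L2_set_def norm_mult sum_3)

lemma Jstar_symmetric: "cinner (Jstar u) v = cinner u (Jstar v)"
  by (simp add: Jstar_def cinner_def sum_3)

lemma Jstar_add: "Jstar (u + v) = Jstar u + Jstar v"
  by (simp add: Jstar_def vec_eq_iff algebra_simps)

lemma Jstar_csc: "Jstar (csc c u) = csc c (Jstar u)"
  by (simp add: Jstar_def csc_def vec_eq_iff)

lemma csc_simps: "csc 1 u = u" "csc 0 u = 0" "csc (-1) u = - u" "csc c (csc d u) = csc (c * d) u"
  "csc (- c) u = - csc c u"
  by (simp_all add: csc_def vec_eq_iff)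

lemma bounded_linear_csc: "bounded_linear (csc c)"
  by (rule bounded_linear_intro[where K="cmod c"])
    (simp_all add: norm_csc mult.commute, simp_all add: csc_def vec_eq_iff algebra_simps)

lemma borel_measurable_csc [measurable]:
  "f \<in> borel_measurable M \<Longrightarrow> (\<lambda>x. csc c (f x)) \<in> borel_measurable M"
  unfolding csc_def
  by (rule borel_measurable_continuous_on[where f="\<lambda>v. \<chi> j. c * v$j"]) (auto intro!: continuous_intros)

lemma borel_measurable_Jstar [measurable]:
  "f \<in> borel_measurable M \<Longrightarrow> (\<lambda>x. Jstar (f x)) \<in> borel_measurable M"
proof (rule borel_measurable_continuous_on[where f=Jstar])
  have "continuous_on UNIV (\<lambda>v::cvec. \<i> * (if j = 1 then - v$2 else if j = 2 then v$1 else 0))" for j :: 3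
    by (cases "j = 1"; cases "j = 2") (auto intro!: continuous_intros)
  then show "continuous_on UNIV Jstar" unfolding Jstar_def[abs_def] by (intro continuous_on_vec_lambda)
qed

lemma borel_measurable_cinner [measurable]:
  assumes "f \<in> borel_measurable M" "g \<in> borel_measurable M"
  shows "(\<lambda>x. cinner (f x) (g x)) \<in> borel_measurable M"
proof -
  have c: "(\<lambda>x. h x $ i) \<in> borel_measurable M"
    if "h \<in> borel_measurable M" for h :: "'a \<Rightarrow> cvec" and i
    using that by (rule borel_measurable_continuous_on[rotated]) (intro continuous_intros)
  have d: "(\<lambda>x. cnj (g x $ i)) \<in> borel_measurable M" for i
    using c[OF assms(2)] by (rule borel_measurable_continuous_on[rotated]) (intro continuous_intros)
  show ?thesis unfolding cinner_def by (intro borel_measurable_sum borel_measurable_times c d assms)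
qed

text \<open>The concrete counterpart of \<open>lc\<close>, shared by \<open>L^2\<close> and by the
  test fields, so that one locale serves the weighted inner product, the form of the operator and
  their sum.\<close>

definition vlc :: "field \<Rightarrow> complex \<Rightarrow> field \<Rightarrow> field" where
  "vlc \<phi> c \<psi> = (\<lambda>x. \<phi> x + csc c (\<psi> x))"

lemma vlc_minus: "vlc \<phi> (- 1) \<psi> = (\<lambda>x. \<phi> x - \<psi> x)"
  by (simp add: vlc_def csc_simps)

lemma Cauchy_fast_subsequence:
  fixes d :: "nat \<Rightarrow> nat \<Rightarrow> real"
  assumes "\<And>e. e > 0 \<Longrightarrow> \<exists>N. \<forall>m\<ge>N. \<forall>n\<ge>N. d m n < e"
  obtains r :: "nat \<Rightarrow> nat" where "\<And>k. k \<le> r k" "\<And>k. d (r (Suc k)) (r k) < (1/2) ^ k"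
proof -
  have "\<exists>N. \<forall>m\<ge>N. \<forall>n\<ge>N. d m n < (1/2) ^ k" for k by (rule assms) simp
  then obtain N where N: "\<And>k m n. \<lbrakk>m \<ge> N k; n \<ge> N k\<rbrakk> \<Longrightarrow> d m n < (1/2) ^ k" by metis
  \<comment> \<open>Summing the thresholds makes \<open>r\<close> monotone and at least
    \<open>N k\<close>; the extra \<open>k\<close> makes it at least \<open>k\<close>.\<close>
  define r where "r k = (\<Sum>j\<le>k. N j) + k" for k
  have "N k \<le> r k" for k unfolding r_def by (rule trans_le_add1) (rule member_le_sum, auto)
  moreover have "r k \<le> r (Suc k)" for k by (simp add: r_def)
  ultimately have "d (r (Suc k)) (r k) < (1/2) ^ k" for k by (meson N order_trans)
  moreover have "k \<le> r k" for k by (simp add: r_def)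
  ultimately show ?thesis using that by blast
qed

lemma norm_sum_sq: "(norm (x + y))\<^sup>2 \<le> 2 * (norm x)\<^sup>2 + 2 * (norm (y::'z::real_normed_vector))\<^sup>2"
proof -
  have "(norm (x + y))\<^sup>2 \<le> (norm x + norm y)\<^sup>2" by (simp add: norm_triangle_ineq power_mono)
  also have "\<dots> \<le> 2 * (norm x)\<^sup>2 + 2 * (norm y)\<^sup>2"
    using zero_le_power2[of "norm x - norm y"] unfolding power2_sum power2_diff by linarith
  finally show ?thesis .
qed

section \<open>The weighted square integrable fields as a semi-inner product space\<close>

locale weighted_region =
  fixes U :: "pt set" and w :: "pt \<Rightarrow> real"
  assumes U_sets [measurable]: "U \<in> sets borel"
    and w_meas [measurable]: "w \<in> borel_measurable borel"
    and w_pos: "x \<in> U \<Longrightarrow> 0 < w x"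
begin

lemma Hsp_meas: "\<xi> \<in> Hsp U w \<Longrightarrow> \<xi> \<in> borel_measurable borel"
  by (simp add: Hsp_def)

lemma Hsp_bounded_sq:
  assumes [measurable]: "\<xi> \<in> borel_measurable borel"
    and u: "u \<in> Hsp U w" and v: "v \<in> Hsp U w"
    and le: "\<And>x. x \<in> U \<Longrightarrow> (norm (\<xi> x))\<^sup>2 \<le> a * (norm (u x))\<^sup>2 + b * (norm (v x))\<^sup>2"
  shows "\<xi> \<in> Hsp U w"
proof -
  have "set_integrable lborel U (\<lambda>x. a * (w x * (norm (u x))\<^sup>2) + b * (w x * (norm (v x))\<^sup>2))"
    using u v by (intro set_integral_add set_integrable_mult_right) (auto simp: Hsp_def)
  then have "set_integrable lborel U (\<lambda>x. w x * (norm (\<xi> x))\<^sup>2)"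
    unfolding set_integrable_def
  proof (rule Bochner_Integration.integrable_bound)
    show "(\<lambda>x. indicat_real U x *\<^sub>R (w x * (norm (\<xi> x))\<^sup>2)) \<in> borel_measurable lborel" by measurable
    have "w x * (norm (\<xi> x))\<^sup>2 \<le> \<bar>a * (w x * (norm (u x))\<^sup>2) + b * (w x * (norm (v x))\<^sup>2)\<bar>"
      if "x \<in> U" for x
    proof -
      have "w x * (norm (\<xi> x))\<^sup>2 \<le> w x * (a * (norm (u x))\<^sup>2 + b * (norm (v x))\<^sup>2)"
        using le[OF that] w_pos[OF that] by simp
      then show ?thesis by (simp add: algebra_simps)
    qed
    then show "AE x in lborel. norm (indicat_real U x *\<^sub>R (w x * (norm (\<xi> x))\<^sup>2))
        \<le> norm (indicat_real U x *\<^sub>R (a * (w x * (norm (u x))\<^sup>2) + b * (w x * (norm (v x))\<^sup>2)))"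
      using w_pos by (auto simp: indicator_def abs_mult less_imp_le)
  qed
  then show ?thesis by (simp add: Hsp_def)
qed

lemma Hsp_vlc: "\<lbrakk>u \<in> Hsp U w; v \<in> Hsp U w\<rbrakk> \<Longrightarrow> vlc u c v \<in> Hsp U w"
proof -
  assume u: "u \<in> Hsp U w" and v: "v \<in> Hsp U w"
  note [measurable] = Hsp_meas[OF u] Hsp_meas[OF v]
  show ?thesis
  proof (rule Hsp_bounded_sq[OF _ u v])
    show "(norm (vlc u c v x))\<^sup>2 \<le> 2 * (norm (u x))\<^sup>2 + (2 * (cmod c)\<^sup>2) * (norm (v x))\<^sup>2" for x
      using norm_sum_sq[of "u x" "csc c (v x)"]
      by (simp add: vlc_def norm_csc power_mult_distrib mult.assoc)
  qed (simp add: vlc_def)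
qed

lemma Hsp_diff: "\<lbrakk>u \<in> Hsp U w; v \<in> Hsp U w\<rbrakk> \<Longrightarrow> (\<lambda>x. u x - v x) \<in> Hsp U w"
  using Hsp_vlc[of u v "-1"] by (simp add: vlc_minus)

lemma Hsp_Jstar: "u \<in> Hsp U w \<Longrightarrow> (\<lambda>x. Jstar (u x)) \<in> Hsp U w"
proof -
  assume u: "u \<in> Hsp U w"
  note [measurable] = Hsp_meas[OF u]
  show ?thesis
    by (rule Hsp_bounded_sq[OF _ u u, where a=1 and b=0]) (auto simp: norm_Jstar_le power_mono)
qed

lemma Hsp_zero: "(\<lambda>x. 0) \<in> Hsp U w"
  by (simp add: Hsp_def set_integrable_def)

lemma Hinner_integrable:
  assumes u: "u \<in> Hsp U w" and v: "v \<in> Hsp U w"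
  shows "set_integrable lborel U (\<lambda>x. complex_of_real (w x) * cinner (u x) (v x))"
proof -
  note [measurable] = Hsp_meas[OF u] Hsp_meas[OF v]
  have "set_integrable lborel U (\<lambda>x. (1/2) * (w x * (norm (u x))\<^sup>2) + (1/2) * (w x * (norm (v x))\<^sup>2))"
    using u v by (intro set_integral_add set_integrable_mult_right) (auto simp: Hsp_def)
  then show ?thesis
    unfolding set_integrable_def
  proof (rule Bochner_Integration.integrable_bound)
    show "(\<lambda>x. indicat_real U x *\<^sub>R (complex_of_real (w x) * cinner (u x) (v x)))
        \<in> borel_measurable lborel" by measurable
    have "w x * cmod (cinner (u x) (v x))
        \<le> \<bar>(1/2) * (w x * (norm (u x))\<^sup>2) + (1/2) * (w x * (norm (v x))\<^sup>2)\<bar>" if "x \<in> U" for x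
    proof -
      have "w x * cmod (cinner (u x) (v x)) \<le> w x * (((norm (u x))\<^sup>2 + (norm (v x))\<^sup>2) / 2)"
        using cmod_cinner_le w_pos[OF that] by simp
      then show ?thesis by (simp add: algebra_simps)
    qed
    then show "AE x in lborel. norm (indicat_real U x *\<^sub>R (complex_of_real (w x) * cinner (u x) (v x)))
        \<le> norm (indicat_real U x *\<^sub>R ((1/2) * (w x * (norm (u x))\<^sup>2) + (1/2) * (w x * (norm (v x))\<^sup>2)))"
      using w_pos by (auto simp: indicator_def norm_mult less_imp_le)
  qed
qed

lemma Hinner_self: "Hinner U w u u = of_real (LINT x:U|lborel. w x * (norm (u x))\<^sup>2)"
  unfolding Hinner_def set_lebesgue_integral_def cinner_self
  by (subst integral_complex_of_real[symmetric]) (simp add: scaleR_conv_of_real)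

lemma Hinner_self_nonneg: "0 \<le> (LINT x:U|lborel. w x * (norm (u x))\<^sup>2)"
  unfolding set_lebesgue_integral_def
  by (rule Bochner_Integration.integral_nonneg) (use w_pos in \<open>auto simp: indicator_def less_imp_le\<close>)

sublocale H: semi_inner_space "Hsp U w" vlc "Hinner U w"
proof
  show "Hsp U w \<noteq> {}" using Hsp_zero by blast
  fix u v z c assume u: "u \<in> Hsp U w" and v: "v \<in> Hsp U w"
  show "vlc u c v \<in> Hsp U w" by (rule Hsp_vlc[OF u v])
  show "0 \<le> Re (Hinner U w u u)" by (simp add: Hinner_self Hinner_self_nonneg)
  show "Hinner U w u v = cnj (Hinner U w v u)"
    unfolding Hinner_def set_lebesgue_integral_def Bochner_Integration.integral_cnj[symmetric]
    by (simp only: cnj_cinner complex_cnj_mult complex_cnj_scaleR complex_cnj_complex_of_real)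
  assume z: "z \<in> Hsp U w"
  show "Hinner U w (vlc u c v) z = Hinner U w u z + c * Hinner U w v z"
  proof -
    have "Hinner U w (vlc u c v) z = (LINT x:U|lborel. complex_of_real (w x) * cinner (u x) (z x)
        + c * (complex_of_real (w x) * cinner (v x) (z x)))"
      by (simp add: Hinner_def vlc_def cinner_add_left cinner_csc_left algebra_simps)
    also have "\<dots> = Hinner U w u z + c * Hinner U w v z"
      unfolding Hinner_def
      by (subst set_integral_add) (auto intro!: set_integrable_mult_right Hinner_integrable u v z)
    finally show ?thesis .
  qed
qed

lemma nrm_eq_Hnorm: "H.nrm = Hnorm U w"
  by (simp add: H.nrm_def Hnorm_def Hinner_self fun_eq_iff)

lemma Hinner_diff_left:
  "\<lbrakk>u \<in> Hsp U w; v \<in> Hsp U w; z \<in> Hsp U w\<rbrakk>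
    \<Longrightarrow> Hinner U w (\<lambda>x. u x - v x) z = Hinner U w u z - Hinner U w v z"
  using H.G_left[of u v z "-1"] by (simp add: vlc_minus)

lemma Hinner_tendsto_left:
  assumes u: "\<And>n. u n \<in> Hsp U w" and v: "v \<in> Hsp U w" and z: "z \<in> Hsp U w"
    and lim: "(\<lambda>n. Hnorm U w (\<lambda>x. u n x - v x)) \<longlonglongrightarrow> 0"
  shows "(\<lambda>n. Hinner U w (u n) z) \<longlonglongrightarrow> Hinner U w v z"
proof -
  have "(\<lambda>n. Hinner U w (u n) z - Hinner U w v z) \<longlonglongrightarrow> 0"
  proof (rule Lim_null_comparison)
    show "\<forall>\<^sub>F n in sequentially. norm (Hinner U w (u n) z - Hinner U w v z)
        \<le> Hnorm U w (\<lambda>x. u n x - v x) * Hnorm U w z"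
    proof (rule always_eventually, rule allI)
      fix n
      show "norm (Hinner U w (u n) z - Hinner U w v z) \<le> Hnorm U w (\<lambda>x. u n x - v x) * Hnorm U w z"
        using H.Cauchy_Schwarz[of "\<lambda>x. u n x - v x" z] u[of n] v z
        by (simp add: Hsp_diff nrm_eq_Hnorm Hinner_diff_left)
    qed
    show "(\<lambda>n. Hnorm U w (\<lambda>x. u n x - v x) * Hnorm U w z) \<longlonglongrightarrow> 0"
      using tendsto_mult_right[OF lim, of "Hnorm U w z"] by simp
  qed
  then show ?thesis by (simp add: LIM_zero_iff)
qed

text \<open>The squared norm with values in the extended nonnegative reals, so that summation under
  the integral and Fatou's lemma apply before the limit is known to be square integrable.\<close>

definition N2 :: "field \<Rightarrow> ennreal" where
  "N2 u = (\<integral>\<^sup>+x. ennreal (indicator U x * (w x * (norm (u x))\<^sup>2)) \<partial>lborel)"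

lemma N2_eq:
  assumes "u \<in> Hsp U w"
  shows "N2 u = ennreal ((Hnorm U w u)\<^sup>2)"
proof -
  have "integrable lborel (\<lambda>x. indicator U x * (w x * (norm (u x))\<^sup>2))"
    using assms by (simp add: Hsp_def set_integrable_def)
  moreover have "AE x in lborel. 0 \<le> indicator U x * (w x * (norm (u x))\<^sup>2)"
    using w_pos by (auto simp: indicator_def less_imp_le)
  ultimately have "N2 u = ennreal (\<integral>x. indicator U x * (w x * (norm (u x))\<^sup>2) \<partial>lborel)"
    unfolding N2_def by (rule nn_integral_eq_integral)
  then show ?thesis
    using Hinner_self_nonneg[of u] by (simp add: Hnorm_def set_lebesgue_integral_def)
qed

lemma N2_finite_Hsp:
  assumes "u \<in> borel_measurable borel" "N2 u < \<infinity>"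
  shows "u \<in> Hsp U w"
proof -
  note [measurable] = assms(1)
  have "integrable lborel (\<lambda>x. indicator U x * (w x * (norm (u x))\<^sup>2))"
  proof (rule integrableI_nonneg)
    show "AE x in lborel. 0 \<le> indicator U x * (w x * (norm (u x))\<^sup>2)"
      using w_pos by (auto simp: indicator_def less_imp_le)
  qed (use assms(2) in \<open>auto simp: N2_def\<close>)
  then show ?thesis using assms(1) by (simp add: Hsp_def set_integrable_def)
qed

text \<open>Riesz-Fischer: a fast subsequence converges almost everywhere on \<open>U\<close>, and
  Fatou's lemma compares the whole sequence with that pointwise limit.\<close>

theorem Hsp_complete:
  assumes u: "\<And>n. u n \<in> Hsp U w"
    and Cauchy: "\<And>e. e > 0 \<Longrightarrow> \<exists>N. \<forall>m\<ge>N. \<forall>n\<ge>N. Hnorm U w (\<lambda>x. u m x - u n x) < e"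
  obtains v where "v \<in> Hsp U w" "(\<lambda>n. Hnorm U w (\<lambda>x. u n x - v x)) \<longlonglongrightarrow> 0"
proof -
  note [measurable] = Hsp_meas[OF u]
  obtain r where rk: "\<And>k. k \<le> r k"
    and r: "\<And>k. Hnorm U w (\<lambda>x. u (r (Suc k)) x - u (r k) x) < (1/2) ^ k"
    using Cauchy_fast_subsequence[of "\<lambda>m n. Hnorm U w (\<lambda>x. u m x - u n x)"] Cauchy by blast
  define d where "d k x = u (r (Suc k)) x - u (r k) x" for k x
  have d: "d k \<in> Hsp U w" for k unfolding d_def by (intro Hsp_diff u)
  note [measurable] = Hsp_meas[OF d]
  have N2d: "N2 (d k) \<le> ennreal ((1/4) ^ k)" for k
  proof -
    have "(Hnorm U w (d k))\<^sup>2 \<le> ((1/2) ^ k)\<^sup>2"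
      using r[of k] by (intro power_mono) (auto simp: d_def[abs_def] Hnorm_def Hinner_self_nonneg)
    then show ?thesis by (simp add: N2_eq[OF d] power2_eq_square flip: power_mult_distrib)
  qed
  \<comment> \<open>The factor \<open>2 ^ k\<close> leaves integrals of at most
    \<open>(1/2) ^ k\<close>, so the sum is finite almost everywhere. Finiteness then yields
    \<open>2 ^ k * w * |d k|^2 \<le> C\<close>, and on \<open>U\<close>, where \<open>w > 0\<close>,
    the increments are dominated by a geometric series of ratio \<open>sqrt (1/2)\<close>.\<close>
  define S where "S k x = ennreal (2 ^ k * (indicator U x * (w x * (norm (d k x))\<^sup>2)))" for k x
  have [measurable]: "S k \<in> borel_measurable lborel" for k unfolding S_def by measurable
  have "(\<integral>\<^sup>+x. (\<Sum>k. S k x) \<partial>lborel) = (\<Sum>k. \<integral>\<^sup>+x. S k x \<partial>lborel)"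
    by (rule nn_integral_suminf) measurable
  also have "\<dots> \<le> (\<Sum>k. ennreal ((1/2) ^ k))"
  proof (rule suminf_le)
    fix k
    have "(\<integral>\<^sup>+x. S k x \<partial>lborel) = ennreal (2 ^ k) * N2 (d k)"
      unfolding S_def N2_def by (subst nn_integral_cmult[symmetric]) (auto simp: ennreal_mult')
    also have "\<dots> \<le> ennreal (2 ^ k) * ennreal ((1/4) ^ k)" using N2d by (rule mult_left_mono) simp
    also have "\<dots> = ennreal ((1/2) ^ k)" by (simp add: flip: ennreal_mult' power_mult_distrib)
    finally show "(\<integral>\<^sup>+x. S k x \<partial>lborel) \<le> ennreal ((1/2) ^ k)" .
  qed auto
  also have "\<dots> < \<infinity>"
    by (subst suminf_ennreal2) (auto intro: summable_geometric)
  finally have fin: "AE x in lborel. (\<Sum>k. S k x) \<noteq> \<infinity>"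
    by (intro nn_integral_PInf_AE) auto
  \<comment> \<open>Where the subsequence diverges, \<open>lim\<close> is an unspecified value.
    Within \<open>U\<close> such points form a null set, and values outside \<open>U\<close> do not
    enter the norm.\<close>
  define v where "v x = lim (\<lambda>k. u (r k) x)" for x
  have v_meas [measurable]: "v \<in> borel_measurable borel" unfolding v_def by measurable
  have conv: "AE x in lborel. x \<in> U \<longrightarrow> (\<lambda>k. u (r k) x) \<longlonglongrightarrow> v x"
    using fin
  proof (rule AE_mp, intro AE_I2 impI)
    fix x assume fx: "(\<Sum>k. S k x) \<noteq> \<infinity>" and xU: "x \<in> U"
    obtain C where C: "(\<Sum>k. S k x) = ennreal C" "C \<ge> 0" using fx by (cases "\<Sum>k. S k x") auto
    have bd: "2 ^ k * (w x * (norm (d k x))\<^sup>2) \<le> C" for k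
    proof -
      have "S k x = sum (\<lambda>k. S k x) {k}" by simp
      also have "\<dots> \<le> ennreal C" unfolding C(1)[symmetric] by (rule sum_le_suminf) auto
      finally show ?thesis using C(2) xU by (simp add: S_def)
    qed
    have "norm (d k x) \<le> sqrt (C / w x) * (sqrt (1/2)) ^ k" for k
    proof (rule power2_le_imp_le)
      have "(norm (d k x))\<^sup>2 \<le> C / w x * (1/2) ^ k"
        using bd[of k] w_pos[OF xU] by (simp add: field_simps power_divide)
      then show "(norm (d k x))\<^sup>2 \<le> (sqrt (C / w x) * (sqrt (1/2)) ^ k)\<^sup>2"
        using C(2) w_pos[OF xU] by (simp add: power_mult_distrib flip: real_sqrt_power)
    qed (use C(2) w_pos[OF xU] in auto)
    moreover have "summable (\<lambda>k. sqrt (C / w x) * (sqrt (1/2)) ^ k)"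
      by (intro summable_mult summable_geometric) (simp add: real_sqrt_lt_1_iff)
    ultimately have "summable (\<lambda>k. d k x)" by (intro summable_comparison_test'[where N=0 and f="\<lambda>k. d k x"])
    then have "convergent (\<lambda>n. \<Sum>k<n. d k x)" by (rule summable_iff_convergent[THEN iffD1])
    then have "convergent (\<lambda>n. u (r n) x - u (r 0) x)"
      unfolding d_def sum_lessThan_telescope[of "\<lambda>k. u (r k) x"] .
    then have "convergent (\<lambda>n. u (r n) x - u (r 0) x + u (r 0) x)"
      by (intro convergent_add convergent_const)
    then show "(\<lambda>k. u (r k) x) \<longlonglongrightarrow> v x" unfolding v_def by (simp add: convergent_LIMSEQ_iff)
  qed
  have Fatou: "\<exists>N. \<forall>n\<ge>N. N2 (\<lambda>x. u n x - v x) \<le> ennreal (e\<^sup>2)" if e: "e > 0" for e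
  proof -
    obtain N where N: "\<And>m n. \<lbrakk>m \<ge> N; n \<ge> N\<rbrakk> \<Longrightarrow> Hnorm U w (\<lambda>x. u m x - u n x) < e"
      using Cauchy[OF e] by blast
    show ?thesis
    proof (intro exI allI impI)
      fix n assume n: "n \<ge> N"
      \<comment> \<open>The index \<open>n\<close> stays fixed while \<open>k\<close> tends to
        infinity; \<open>r k \<ge> k\<close> brings the subsequence into the Cauchy range.\<close>
      define F where "F k x = ennreal (indicator U x * (w x * (norm (u n x - u (r k) x))\<^sup>2))" for k x
      have [measurable]: "F k \<in> borel_measurable lborel" for k unfolding F_def by measurable
      have "N2 (\<lambda>x. u n x - v x) = (\<integral>\<^sup>+x. liminf (\<lambda>k. F k x) \<partial>lborel)"
        unfolding N2_def
      proof (rule nn_integral_cong_AE, rule AE_mp[OF conv], intro AE_I2 impI)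
        fix x assume "x \<in> U \<longrightarrow> (\<lambda>k. u (r k) x) \<longlonglongrightarrow> v x"
        then have "(\<lambda>k. F k x) \<longlonglongrightarrow> ennreal (indicator U x * (w x * (norm (u n x - v x))\<^sup>2))"
          unfolding F_def by (cases "x \<in> U") (auto intro!: tendsto_intros)
        then show "ennreal (indicator U x * (w x * (norm (u n x - v x))\<^sup>2)) = liminf (\<lambda>k. F k x)"
          by (simp add: lim_imp_Liminf)
      qed
      also have "\<dots> \<le> liminf (\<lambda>k. \<integral>\<^sup>+x. F k x \<partial>lborel)"
        by (rule nn_integral_liminf) measurable
      also have "\<dots> \<le> ennreal (e\<^sup>2)"
      proof (rule Liminf_le)
        have "(\<integral>\<^sup>+x. F k x \<partial>lborel) \<le> ennreal (e\<^sup>2)" if "k \<ge> N" for k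
        proof -
          have "(Hnorm U w (\<lambda>x. u n x - u (r k) x))\<^sup>2 \<le> e\<^sup>2"
            using N[OF n, of "r k"] rk[of k] that
            by (intro power_mono) (auto simp: Hnorm_def Hinner_self_nonneg)
          then show ?thesis
            using N2_eq[OF Hsp_diff[OF u u], of n "r k"] by (simp add: N2_def F_def ennreal_leI)
        qed
        then show "\<forall>\<^sub>F k in sequentially. (\<integral>\<^sup>+x. F k x \<partial>lborel) \<le> ennreal (e\<^sup>2)"
          by (auto simp: eventually_sequentially)
      qed simp
      finally show "N2 (\<lambda>x. u n x - v x) \<le> ennreal (e\<^sup>2)" .
    qed
  qed
  have diff: "(\<lambda>x. u n x - v x) \<in> Hsp U w" if "N2 (\<lambda>x. u n x - v x) \<le> ennreal (e\<^sup>2)" for n e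
    using that by (intro N2_finite_Hsp) (auto simp: le_less_trans)
  have vH: "v \<in> Hsp U w"
  proof -
    obtain n where "N2 (\<lambda>x. u n x - v x) \<le> ennreal (1\<^sup>2)" using Fatou[of 1] by auto
    from Hsp_diff[OF u diff[OF this], of n] show ?thesis by simp
  qed
  show ?thesis
  proof (rule that[OF vH], rule LIMSEQ_I)
    fix e :: real assume e: "e > 0"
    \<comment> \<open>Fatou gives only a non-strict bound, so half of \<open>e\<close> is
      requested.\<close>
    obtain N where N: "\<And>n. n \<ge> N \<Longrightarrow> N2 (\<lambda>x. u n x - v x) \<le> ennreal ((e/2)\<^sup>2)"
      using Fatou[of "e/2"] e by auto
    show "\<exists>no. \<forall>n\<ge>no. norm (Hnorm U w (\<lambda>x. u n x - v x) - 0) < e"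
    proof (intro exI allI impI)
      fix n assume "n \<ge> N"
      from N[OF this] have "(Hnorm U w (\<lambda>x. u n x - v x))\<^sup>2 \<le> (e/2)\<^sup>2"
        by (simp add: N2_eq Hsp_diff u vH del: power_divide)
      then have "Hnorm U w (\<lambda>x. u n x - v x) \<le> e/2" by (rule power2_le_imp_le) (use e in simp)
      moreover have "0 \<le> Hnorm U w (\<lambda>x. u n x - v x)" by (simp add: Hnorm_def Hinner_self_nonneg)
      ultimately show "norm (Hnorm U w (\<lambda>x. u n x - v x) - 0) < e" using e by simp
    qed
  qed
qed

end

section \<open>Iterated partial derivatives and integration by parts\<close>

text \<open>Carries the existence of the derivative, which \<open>pd\<close> does not: its value is
  unspecified where the restriction to the line is not differentiable.\<close>

definition has_pd :: "3 \<Rightarrow> (pt \<Rightarrow> 'b::real_normed_vector) \<Rightarrow> pt \<Rightarrow> 'b \<Rightarrow> bool" where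
  "has_pd i f x D \<longleftrightarrow> ((\<lambda>t. f (x + t *\<^sub>R axis i 1)) has_vector_derivative D) (at 0)"

lemma pd_eqI: "has_pd i f x D \<Longrightarrow> pd i f x = D"
  unfolding has_pd_def pd_def by (rule vector_derivative_at)

lemma has_pd_iff: "(\<lambda>t. f (x + t *\<^sub>R axis i 1)) differentiable (at 0) \<longleftrightarrow> has_pd i f x (pd i f x)"
  unfolding has_pd_def pd_def by (rule vector_derivative_works)

lemma has_pd_cong:
  assumes "has_pd i f x D" "open U" "x \<in> U" "\<And>y. y \<in> U \<Longrightarrow> f y = g y"
  shows "has_pd i g x D"
  unfolding has_pd_def
proof (rule has_vector_derivative_transform_within_open)
  show "((\<lambda>t. f (x + t *\<^sub>R axis i 1)) has_vector_derivative D) (at 0)"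
    using assms(1) by (simp add: has_pd_def)
  show "open ((\<lambda>t. x + t *\<^sub>R axis i 1) -` U)"
    using assms(2) by (intro open_vimage continuous_intros)
qed (use assms in auto)

lemma has_pd_add: "\<lbrakk>has_pd i f x D; has_pd i g x D'\<rbrakk> \<Longrightarrow> has_pd i (\<lambda>x. f x + g x) x (D + D')"
  unfolding has_pd_def by (rule has_vector_derivative_add)

lemma has_pd_linear: "\<lbrakk>bounded_linear T; has_pd i f x D\<rbrakk> \<Longrightarrow> has_pd i (\<lambda>x. T (f x)) x (T D)"
  unfolding has_pd_def by (rule bounded_linear.has_vector_derivative)

lemma has_pd_mult:
  fixes f g :: "pt \<Rightarrow> 'b::real_normed_algebra"
  shows "\<lbrakk>has_pd i f x D; has_pd i g x D'\<rbrakk> \<Longrightarrow> has_pd i (\<lambda>x. f x * g x) x (f x * D' + D * g x)"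
  unfolding has_pd_def using has_vector_derivative_mult[of "\<lambda>t. f (x + t *\<^sub>R axis i 1)" D 0 UNIV "\<lambda>t. g (x + t *\<^sub>R axis i 1)" D'] by simp

lemma has_pd_const: "has_pd i (\<lambda>x. c) x 0"
  unfolding has_pd_def by (rule has_vector_derivative_const)

lemma has_pd_ident: "has_pd i (\<lambda>x. x) x (axis i 1)"
  unfolding has_pd_def by (auto intro!: derivative_eq_intros)

lemma has_pd_powr:
  fixes f :: "pt \<Rightarrow> real"
  assumes "has_pd i f x D" "f x > 0"
  shows "has_pd i (\<lambda>x. f x powr a) x (a * f x powr (a - 1) * D)"
proof -
  have "((\<lambda>t. f (x + t *\<^sub>R axis i 1)) has_real_derivative D) (at 0)"
    using assms(1) by (simp add: has_pd_def has_real_derivative_iff_has_vector_derivative)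
  from DERIV_chain2[OF has_real_derivative_powr this, of a] assms(2)
  show ?thesis by (simp add: has_pd_def has_real_derivative_iff_has_vector_derivative)
qed

lemma pd_zero_outside:
  assumes "closed K" "\<And>x. x \<notin> K \<Longrightarrow> f x = 0" "x \<notin> K"
  shows "has_pd i f x 0" "pd i f x = 0"
proof -
  show "has_pd i f x 0"
    by (rule has_pd_cong[OF has_pd_const[of i 0], where U="- K"]) (use assms in auto)
  then show "pd i f x = 0" by (rule pd_eqI)
qed

section \<open>Calculus of functions with continuous iterated partial derivatives on an open
  set\<close>

fun ck :: "nat \<Rightarrow> pt set \<Rightarrow> (pt \<Rightarrow> 'b::real_normed_vector) \<Rightarrow> bool" where
  "ck 0 U f \<longleftrightarrow> continuous_on U f"
| "ck (Suc n) U f \<longleftrightarrow> continuous_on U f \<and> (\<forall>i. (\<forall>x\<in>U. has_pd i f x (pd i f x)) \<and> ck n U (pd i f))"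

lemma ck_continuous: "ck n U f \<Longrightarrow> continuous_on U f"
  by (cases n) auto

lemma ck_has_pd: "\<lbrakk>ck (Suc n) U f; x \<in> U\<rbrakk> \<Longrightarrow> has_pd i f x (pd i f x)"
  by auto

lemma ck_pd: "ck (Suc n) U f \<Longrightarrow> ck n U (pd i f)"
  by auto

lemma ck_Suc_D: "ck (Suc n) U f \<Longrightarrow> ck n U f"
proof (induction n arbitrary: f)
  case 0
  then show ?case by simp
next
  case (Suc n)
  have "ck n U (pd i f)" for i by (rule Suc.IH[OF ck_pd[OF Suc.prems]])
  then show ?case using Suc.prems by simp
qed

lemma ck_cong:
  assumes "open U" "\<And>x. x \<in> U \<Longrightarrow> f x = g x" "ck n U f"
  shows "ck n U g"
  using assms(2,3)
proof (induction n arbitrary: f g)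
  case 0
  then show ?case using continuous_on_cong[of U U f g] by simp
next
  case (Suc n)
  have h: "has_pd i g x (pd i f x)" if "x \<in> U" for i x
    by (rule has_pd_cong[OF ck_has_pd[OF Suc.prems(2) that] assms(1) that Suc.prems(1)])
  have pd: "pd i f x = pd i g x" if "x \<in> U" for i x by (rule pd_eqI[OF h[OF that], symmetric])
  have "ck n U (pd i g)" for i by (rule Suc.IH[OF pd ck_pd[OF Suc.prems(2)]])
  moreover have "continuous_on U g" using Suc.prems continuous_on_cong[of U U f g] by simp
  ultimately show ?case using h pd by simp
qed

text \<open>Introduction rule with freely chosen formulas \<open>D\<close> for the derivatives: they
  agree with \<open>pd\<close> on the open set, and \<open>ck\<close> sees nothing else. The closure
  properties below follow by induction with the usual rules for \<open>D\<close>.\<close>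

lemma ck_SucI:
  assumes "open U" "continuous_on U f" "\<And>i x. x \<in> U \<Longrightarrow> has_pd i f x (D i x)" "\<And>i. ck n U (D i)"
  shows "ck (Suc n) U f"
proof -
  have pd: "D i x = pd i f x" if "x \<in> U" for i x by (rule pd_eqI[OF assms(3)[OF that], symmetric])
  have "ck n U (pd i f)" for i by (rule ck_cong[OF assms(1) pd assms(4)])
  then show ?thesis using assms(2,3) pd by simp
qed

lemma ck_subset: "\<lbrakk>ck n U f; V \<subseteq> U\<rbrakk> \<Longrightarrow> ck n V f"
  by (induction n arbitrary: f) (auto intro: continuous_on_subset)

lemma ck_Un: "\<lbrakk>open U; open V; ck n U f; ck n V f\<rbrakk> \<Longrightarrow> ck n (U \<union> V) f"
  by (induction n arbitrary: f) (auto intro: continuous_on_open_Un)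

lemma ck_const: "open U \<Longrightarrow> ck n U (\<lambda>x. c)"
  by (induction n arbitrary: c) (auto intro!: ck_SucI[where D="\<lambda>i x. 0"] has_pd_const simp del: ck.simps(2))

lemma ck_ident: "open U \<Longrightarrow> ck n U (\<lambda>x. x)"
  by (cases n) (auto intro!: ck_SucI[where D="\<lambda>i x. axis i 1"] has_pd_ident ck_const simp del: ck.simps(2))

lemma ck_linear:
  assumes T: "bounded_linear T" and U: "open U"
  shows "ck n U f \<Longrightarrow> ck n U (\<lambda>x. T (f x))"
proof (induction n arbitrary: f)
  case 0
  then show ?case using bounded_linear.continuous_on[OF T] by simp
next
  case (Suc n)
  show ?case
    by (rule ck_SucI[where D="\<lambda>i x. T (pd i f x)", OF U])
      (use Suc bounded_linear.continuous_on[OF T] has_pd_linear[OF T] in auto)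
qed

lemma ck_add:
  assumes U: "open U"
  shows "\<lbrakk>ck n U f; ck n U g\<rbrakk> \<Longrightarrow> ck n U (\<lambda>x. f x + g x)"
proof (induction n arbitrary: f g)
  case 0
  then show ?case by (auto intro: continuous_on_add)
next
  case (Suc n)
  show ?case
    by (rule ck_SucI[where D="\<lambda>i x. pd i f x + pd i g x", OF U])
      (use Suc in \<open>auto intro: continuous_on_add has_pd_add\<close>)
qed

lemma ck_sum:
  assumes U: "open U" and "finite I" "\<And>i. i \<in> I \<Longrightarrow> ck n U (f i)"
  shows "ck n U (\<lambda>x. \<Sum>i\<in>I. f i x)"
  using assms(2,3) by (induction I rule: finite_induct) (auto intro: ck_const ck_add U)

lemma ck_mult:
  fixes f g :: "pt \<Rightarrow> 'b::real_normed_algebra"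
  assumes U: "open U"
  shows "\<lbrakk>ck n U f; ck n U g\<rbrakk> \<Longrightarrow> ck n U (\<lambda>x. f x * g x)"
proof (induction n arbitrary: f g)
  case 0
  then show ?case by (auto intro: continuous_on_mult)
next
  case (Suc n)
  show ?case
  proof (rule ck_SucI[where D="\<lambda>i x. f x * pd i g x + pd i f x * g x", OF U])
    show "ck n U (\<lambda>x. f x * pd i g x + pd i f x * g x)" for i
      by (intro ck_add[OF U] Suc.IH ck_Suc_D[OF Suc.prems(1)] ck_Suc_D[OF Suc.prems(2)]
          ck_pd[OF Suc.prems(1)] ck_pd[OF Suc.prems(2)])
  qed (use Suc.prems in \<open>auto intro: continuous_on_mult has_pd_mult\<close>)
qed

lemma ck_powr:
  fixes f :: "pt \<Rightarrow> real"
  assumes U: "open U" and pos: "\<And>x. x \<in> U \<Longrightarrow> 0 < f x"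
  shows "ck n U f \<Longrightarrow> ck n U (\<lambda>x. f x powr a)"
proof (induction n arbitrary: a)
  case 0
  have "\<forall>x\<in>U. f x \<noteq> 0" using pos by force
  with 0 show ?case by (auto intro!: continuous_on_powr continuous_on_const)
next
  case (Suc n)
  show ?case
  proof (rule ck_SucI[where D="\<lambda>i x. a * f x powr (a - 1) * pd i f x", OF U])
    show "continuous_on U (\<lambda>x. f x powr a)"
      using ck_continuous[OF Suc.prems] pos by (intro continuous_on_powr continuous_on_const) force+
    show "ck n U (\<lambda>x. a * f x powr (a - 1) * pd i f x)" for i
      by (intro ck_mult[OF U] ck_const[OF U] Suc.IH ck_Suc_D[OF Suc.prems] ck_pd[OF Suc.prems])
  qed (use Suc.prems pos in \<open>auto intro: has_pd_powr\<close>)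
qed

text \<open>\<open>U\<close> and \<open>- K\<close> are open and cover the space. This turns
  products of coefficients regular only inside \<open>U\<close> with test fields into global
  functions, so that integration by parts never meets the boundary of \<open>U\<close>.\<close>

lemma ck_zero_extension:
  assumes "open U" "closed K" "K \<subseteq> U" "ck n U f" "\<And>x. x \<notin> K \<Longrightarrow> f x = 0"
  shows "ck n UNIV f"
proof -
  have "ck n (- K) f"
    by (rule ck_cong[OF _ _ ck_const[of "- K" n 0]]) (use assms in auto)
  then have "ck n (U \<union> - K) f" using assms by (intro ck_Un) auto
  moreover have "U \<union> - K = UNIV" using assms(3) by blast
  ultimately show ?thesis by simp
qed

lemma smooth_imp_ck:
  assumes "smooth f"
  shows "ck n UNIV f"
proof -
  have "ck n UNIV (pdl is f)" for "is"
  proof (induction n arbitrary: "is")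
    case 0
    then show ?case using assms by (simp add: smooth_def)
  next
    case (Suc n)
    then show ?case using assms Suc.IH[of "_ # is"] by (simp add: smooth_def has_pd_iff)
  qed
  from this[of "[]"] show ?thesis by simp
qed

text \<open>\<open>has_pd\<close> speaks only about parameter value 0; shifting the base point along
  the line gives the derivative at every parameter, as the mean value estimate needs.\<close>

lemma ck1_line_derivative:
  assumes "ck (Suc 0) UNIV F"
  shows "((\<lambda>t. F (x + t *\<^sub>R axis j 1)) has_vector_derivative pd j F (x + t *\<^sub>R axis j 1)) (at t)"
proof -
  have "has_pd j F (x + t *\<^sub>R axis j 1) (pd j F (x + t *\<^sub>R axis j 1))"
    using assms by (rule ck_has_pd) simp
  then have "((\<lambda>h. F (x + t *\<^sub>R axis j 1 + h *\<^sub>R axis j 1)) has_vector_derivative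
      pd j F (x + t *\<^sub>R axis j 1)) (at (t - t))"
    by (simp add: has_pd_def)
  moreover have "((\<lambda>s. s - t) has_vector_derivative 1) (at t)" by (auto intro!: derivative_eq_intros)
  ultimately have "((\<lambda>h. F (x + t *\<^sub>R axis j 1 + h *\<^sub>R axis j 1)) \<circ> (\<lambda>s. s - t) has_vector_derivative
      1 *\<^sub>R pd j F (x + t *\<^sub>R axis j 1)) (at t)"
    by (intro vector_diff_chain_at) auto
  then show ?thesis by (simp add: o_def algebra_simps)
qed

lemma integrable_compact_support:
  fixes f :: "pt \<Rightarrow> 'b::{banach, second_countable_topology}"
  assumes "continuous_on UNIV f" "compact K" "\<And>x. x \<notin> K \<Longrightarrow> f x = 0"
  shows "integrable lborel f"
proof -
  have "integrable lborel (\<lambda>x. indicator K x *\<^sub>R f x)"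
    using assms by (intro borel_integrable_compact) (auto intro: continuous_on_subset)
  moreover have "(\<lambda>x. indicator K x *\<^sub>R f x) = f" using assms(3) by (auto simp: indicator_def)
  ultimately show ?thesis by simp
qed

lemma has_vector_derivative_quotient:
  fixes f :: "real \<Rightarrow> 'b::real_normed_vector"
  assumes "(f has_vector_derivative D) (at 0)"
  shows "((\<lambda>t. (1 / t) *\<^sub>R (f t - f 0)) \<longlongrightarrow> D) (at 0)"
proof -
  have "((\<lambda>t. norm (f t - f 0 - t *\<^sub>R D) / \<bar>t\<bar>) \<longlongrightarrow> 0) (at 0)"
    using assms by (simp add: has_vector_derivative_def has_derivative_iff_norm)
  moreover have "\<forall>\<^sub>F t in at 0. norm (f t - f 0 - t *\<^sub>R D) / \<bar>t\<bar> = norm ((1 / t) *\<^sub>R (f t - f 0) - D)"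
  proof (rule eventually_at_ball'[THEN eventually_mono, of 1])
    fix t :: real assume "t \<in> ball 0 1 \<and> t \<noteq> 0 \<and> t \<in> UNIV"
    then have "(1 / t) *\<^sub>R (f t - f 0) - D = (1 / t) *\<^sub>R (f t - f 0 - t *\<^sub>R D)"
      by (simp add: scaleR_diff_right)
    then show "norm (f t - f 0 - t *\<^sub>R D) / \<bar>t\<bar> = norm ((1 / t) *\<^sub>R (f t - f 0) - D)" by simp
  qed simp
  ultimately have "((\<lambda>t. norm ((1 / t) *\<^sub>R (f t - f 0) - D)) \<longlongrightarrow> 0) (at 0)"
    by (simp add: tendsto_cong)
  then show ?thesis by (simp add: tendsto_norm_zero_iff LIM_zero_iff)
qed

text \<open>By translation invariance all difference quotients of \<open>F\<close> have integral zero.\<close>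

lemma integral_pd_eq_0:
  fixes F :: "pt \<Rightarrow> 'b::{banach, second_countable_topology}"
  assumes F: "ck (Suc 0) UNIV F" and K: "compact K" and supp: "\<And>x. x \<notin> K \<Longrightarrow> F x = 0"
  shows "integral\<^sup>L lborel (pd j F) = 0"
proof -
  let ?e = "axis j 1 :: pt"
  have cF: "continuous_on UNIV F" and cpd: "continuous_on UNIV (pd j F)"
    using F by auto
  have F_meas [measurable]: "F \<in> borel_measurable borel"
    using cF by (rule borel_measurable_continuous_onI)
  have pd0: "pd j F x = 0" if "x \<notin> K" for x
    using pd_zero_outside(2)[of K F] K supp that by (simp add: compact_imp_closed)
  have "compact (pd j F ` K)" using cpd K by (intro compact_continuous_image) (auto intro: continuous_on_subset)
  then obtain M0 where M0: "\<And>x. x \<in> K \<Longrightarrow> norm (pd j F x) \<le> M0"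
    using compact_imp_bounded bounded_iff by (metis image_eqI)
  \<comment> \<open>The maximum with 0 keeps the bound valid outside \<open>K\<close>, where the
    derivative vanishes, and also for empty \<open>K\<close>.\<close>
  define M where "M = max M0 0"
  have M: "norm (pd j F x) \<le> M" for x
    using M0[of x] pd0[of x] by (cases "x \<in> K") (auto simp: M_def)
  obtain b where b: "\<And>x. x \<in> K \<Longrightarrow> norm x \<le> b" using K compact_imp_bounded bounded_iff by metis
  \<comment> \<open>Shifts have length at most 1, so one ball contains the supports of all
    difference quotients, and \<open>M\<close> times its indicator dominates them.\<close>
  define C where "C = cball (0::pt) (b + 1)"
  define h where "h n = 1 / real (Suc n)" for n
  have h: "0 < h n" "h n \<le> 1" for n by (auto simp: h_def)
  define g where "g n x = (1 / h n) *\<^sub>R (F (x + h n *\<^sub>R ?e) - F x)" for n x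
  have g_le: "norm (g n x) \<le> M" for n x
  proof -
    \<comment> \<open>The mean value inequality on the line bounds the quotients uniformly by the
      bound of the derivative.\<close>
    have "norm (F (x + h n *\<^sub>R ?e) - F (x + 0 *\<^sub>R ?e)) \<le> M * norm (h n - 0)"
    proof (rule differentiable_bound[where S=UNIV and f'="\<lambda>t s. s *\<^sub>R pd j F (x + t *\<^sub>R ?e)"])
      show "onorm (\<lambda>s. s *\<^sub>R pd j F (x + t *\<^sub>R ?e)) \<le> M" for t
        by (rule onorm_le) (use M in \<open>simp add: mult.commute[of M] mult_left_mono\<close>)
    qed (use ck1_line_derivative[OF F, of x j] in \<open>auto simp: has_vector_derivative_def\<close>)
    then have "norm (F (x + h n *\<^sub>R ?e) - F x) \<le> M * h n" using h[of n] by simp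
    then show ?thesis using h[of n] unfolding g_def norm_scaleR by (simp add: field_simps)
  qed
  have g_supp: "g n x = 0" if "x \<notin> C" for n x
  proof -
    have "norm x \<le> norm (x + h n *\<^sub>R ?e) + norm (h n *\<^sub>R ?e)"
      by (metis add_diff_cancel_right' norm_triangle_ineq4)
    also have "norm (h n *\<^sub>R ?e) \<le> 1" using h[of n] by simp
    finally have "norm x \<le> norm (x + h n *\<^sub>R ?e) + 1" by simp
    then have "x \<notin> K" "x + h n *\<^sub>R ?e \<notin> K" using that b by (force simp: C_def)+
    then show ?thesis by (simp add: g_def supp)
  qed
  have int: "integrable lborel F" using cF K supp by (rule integrable_compact_support)
  have int_t: "integrable lborel (\<lambda>x. F (x + c))" and tr: "(\<integral>x. F (x + c) \<partial>lborel) = integral\<^sup>L lborel F" for c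
  proof -
    have d: "lborel = distr lborel borel ((+) c)" by (rule lborel_distr_plus[symmetric])
    have "integrable (distr lborel borel ((+) c)) F" using int d by simp
    then show "integrable lborel (\<lambda>x. F (x + c))" by (simp add: integrable_distr_eq add.commute)
    have "integral\<^sup>L lborel F = integral\<^sup>L (distr lborel borel ((+) c)) F" using d by simp
    then show "(\<integral>x. F (x + c) \<partial>lborel) = integral\<^sup>L lborel F" by (simp add: integral_distr add.commute)
  qed
  have "integral\<^sup>L lborel (g n) = 0" for n
    unfolding g_def by (simp add: int int_t tr)
  moreover have "(\<lambda>n. integral\<^sup>L lborel (g n)) \<longlonglongrightarrow> integral\<^sup>L lborel (pd j F)"
  proof (rule integral_dominated_convergence[where w="\<lambda>x. M * indicator C x"])
    show "pd j F \<in> borel_measurable lborel" using borel_measurable_continuous_onI[OF cpd] by simp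
    show "g n \<in> borel_measurable lborel" for n unfolding g_def by measurable
    have "emeasure lborel C < \<infinity>" unfolding C_def by (rule emeasure_lborel_cball_finite)
    moreover have "C \<in> sets lborel" by (simp add: C_def)
    ultimately show "integrable lborel (\<lambda>x. M * indicator C x)"
      by (intro integrable_mult_right) (simp add: less_top)
    show "AE x in lborel. norm (g n x) \<le> M * indicator C x" for n
      using g_le g_supp by (auto simp: indicator_def)
    have h0: "filterlim h (at 0) sequentially"
      using LIMSEQ_inverse_real_of_nat
      by (auto intro!: always_eventually simp: filterlim_at h_def[abs_def] inverse_eq_divide)
    show "AE x in lborel. (\<lambda>n. g n x) \<longlonglongrightarrow> pd j F x"
    proof (rule AE_I2)
      fix x
      have "((\<lambda>t. F (x + t *\<^sub>R ?e)) has_vector_derivative pd j F x) (at 0)"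
        using ck1_line_derivative[OF F, of x j 0] by simp
      then have "((\<lambda>t. (1 / t) *\<^sub>R (F (x + t *\<^sub>R ?e) - F (x + 0 *\<^sub>R ?e))) \<longlongrightarrow> pd j F x) (at 0)"
        by (rule has_vector_derivative_quotient)
      then show "(\<lambda>n. g n x) \<longlonglongrightarrow> pd j F x"
        using filterlim_compose[OF _ h0] by (simp add: g_def)
    qed
  qed
  ultimately show ?thesis by (simp add: LIMSEQ_const_iff)
qed

text \<open>The derivative of \<open>f * g\<close> has integral zero; the compact support of
  \<open>f\<close> makes both terms of the product rule integrable.\<close>

lemma integration_by_parts:
  fixes f g :: "pt \<Rightarrow> complex"
  assumes f: "ck (Suc 0) UNIV f" and g: "ck (Suc 0) UNIV g"
    and K: "compact K" and supp: "\<And>x. x \<notin> K \<Longrightarrow> f x = 0"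
  shows "(\<integral>x. pd j f x * g x \<partial>lborel) = - (\<integral>x. f x * pd j g x \<partial>lborel)"
proof -
  have pd0: "pd j f x = 0" if "x \<notin> K" for x
    using pd_zero_outside(2)[of K f] K supp that by (simp add: compact_imp_closed)
  have c: "continuous_on UNIV f" "continuous_on UNIV g" "continuous_on UNIV (pd j f)" "continuous_on UNIV (pd j g)"
    using f g by auto
  have "0 = integral\<^sup>L lborel (pd j (\<lambda>x. f x * g x))"
    by (rule integral_pd_eq_0[symmetric, OF ck_mult[OF _ f g] K]) (auto simp: supp)
  also have "pd j (\<lambda>x. f x * g x) = (\<lambda>x. f x * pd j g x + pd j f x * g x)"
    using ck_has_pd[OF f] ck_has_pd[OF g] by (auto intro!: pd_eqI has_pd_mult)
  also have "integral\<^sup>L lborel \<dots> = (\<integral>x. f x * pd j g x \<partial>lborel) + (\<integral>x. pd j f x * g x \<partial>lborel)"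
    using c by (intro Bochner_Integration.integral_add integrable_compact_support[OF _ K] continuous_intros)
      (auto simp: supp pd0)
  finally show ?thesis by (simp add: eq_neg_iff_add_eq_0 add.commute)
qed

section \<open>The pencil on a general region\<close>

lemma has_pd_vlc:
  assumes "smooth \<phi>" "smooth \<psi>"
  shows "has_pd i (vlc (pdl is \<phi>) c (pdl is \<psi>)) x (pd i (pdl is \<phi>) x + csc c (pd i (pdl is \<psi>) x))"
  unfolding vlc_def
  by (intro has_pd_add has_pd_linear[OF bounded_linear_csc])
    (use assms in \<open>simp_all add: smooth_def has_pd_iff\<close>)

lemma pdl_vlc:
  assumes "smooth \<phi>" "smooth \<psi>"
  shows "pdl is (vlc \<phi> c \<psi>) = vlc (pdl is \<phi>) c (pdl is \<psi>)"
proof (induction "is")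
  case (Cons i "is")
  have "pd i (vlc (pdl is \<phi>) c (pdl is \<psi>)) = vlc (pd i (pdl is \<phi>)) c (pd i (pdl is \<psi>))"
    by (rule ext, subst pd_eqI[OF has_pd_vlc[OF assms]]) (simp add: vlc_def)
  with Cons.IH show ?case by simp
qed simp

lemma smooth_vlc:
  assumes "smooth \<phi>" "smooth \<psi>"
  shows "smooth (vlc \<phi> c \<psi>)"
  unfolding smooth_def pdl_vlc[OF assms]
proof (intro allI conjI)
  fix "is"
  show "continuous_on UNIV (vlc (pdl is \<phi>) c (pdl is \<psi>))"
    using assms unfolding vlc_def smooth_def
    by (intro continuous_on_add bounded_linear.continuous_on[OF bounded_linear_csc]) auto
  show "(\<lambda>t. vlc (pdl is \<phi>) c (pdl is \<psi>) (x + t *\<^sub>R axis i 1)) differentiable (at 0)" for i x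
    using has_pd_vlc[OF assms] unfolding has_pd_def by (rule differentiableI_vector)
qed

lemma smooth_zero: "smooth (\<lambda>x. 0 :: 'b::real_normed_vector)"
proof -
  have "pdl is (\<lambda>x. 0 :: 'b) = (\<lambda>x. 0)" for "is"
    by (induction "is") (auto intro!: pd_eqI has_pd_const)
  then show ?thesis by (simp add: smooth_def)
qed

lemma C0inf_zero: "(\<lambda>x. 0) \<in> C0inf U"
  by (simp add: C0inf_def smooth_zero tsupp_def)

lemma outside_tsupp: "x \<notin> tsupp \<phi> \<Longrightarrow> \<phi> x = 0"
  using closure_subset[of "{x. \<phi> x \<noteq> 0}"] by (auto simp: tsupp_def)

lemma C0inf_vlc:
  assumes "\<phi> \<in> C0inf U" "\<psi> \<in> C0inf U"
  shows "vlc \<phi> c \<psi> \<in> C0inf U"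
proof -
  have "tsupp (vlc \<phi> c \<psi>) \<subseteq> tsupp \<phi> \<union> tsupp \<psi>"
    unfolding tsupp_def closure_Un[symmetric]
    by (rule closure_mono) (auto simp: vlc_def csc_def vec_eq_iff)
  moreover have "compact (tsupp \<phi> \<union> tsupp \<psi>)" using assms by (auto simp: C0inf_def)
  moreover have "closed (tsupp (vlc \<phi> c \<psi>))" by (simp add: tsupp_def)
  ultimately have "compact (tsupp (vlc \<phi> c \<psi>))"
    by (metis compact_Int_closed inf.absorb2)
  then show ?thesis
    using assms \<open>tsupp (vlc \<phi> c \<psi>) \<subseteq> _\<close> by (auto simp: C0inf_def smooth_vlc)
qed

text \<open>The value of the quadratic pencil on a vector with \<open>n = \<parallel>\<xi>\<parallel>\<^sup>2\<close>, \<open>j = \<langle>J\<^sub>\<star>\<xi>,\<xi>\<rangle>\<close>, \<open>a = \<langle>L\<xi>,\<xi>\<rangle>\<close>.\<close>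

lemma Im_pencil_value:
  fixes \<sigma> :: complex and Om n j a :: real
  shows "Im (cnj \<sigma> * (- \<sigma>\<^sup>2 * n + 2 * Om * \<sigma> * j + a)) = - Im \<sigma> * ((cmod \<sigma>)\<^sup>2 * n + a)"
  unfolding cmod_power2 by (simp add: power2_eq_square algebra_simps)

text \<open>The orders 2 and 1 count what the operator differentiates: \<open>rho\<close> under both
  divergence and gradient, \<open>s\<close> under the gradient alone. Regularity is required only
  inside \<open>U\<close>, so nothing is imposed on \<open>s\<close> near the boundary.\<close>

locale acoustic_region =
  fixes U :: "pt set" and rho s :: "pt \<Rightarrow> real"
  assumes U_open: "open U"
    and rho_ck: "ck 2 U rho" and s_ck: "ck 1 U s"
    and rho_pos: "x \<in> U \<Longrightarrow> 0 < rho x" and rho_outside: "x \<notin> U \<Longrightarrow> rho x = 0"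
    and s_nonneg: "0 \<le> s x"
begin

sublocale weighted_region U rho
proof
  show "U \<in> sets borel" using U_open by simp
  have "(\<lambda>x. indicator U x *\<^sub>R rho x) \<in> borel_measurable borel"
    using U_open ck_continuous[OF rho_ck] by (intro borel_measurable_continuous_on_indicator) auto
  moreover have "(\<lambda>x. indicator U x *\<^sub>R rho x) = rho" using rho_outside by (auto simp: fun_eq_iff indicator_def)
  ultimately show "rho \<in> borel_measurable borel" by simp
qed (rule rho_pos)

section \<open>The operator on test fields and its quadratic form\<close>

definition flux_div :: "field \<Rightarrow> pt \<Rightarrow> complex" where
  "flux_div \<phi> y = (\<Sum>i\<in>UNIV. pd i (\<lambda>z. complex_of_real (rho z) * \<phi> z $ i) y)"

text \<open>The weight \<open>rho\<close> of the inner product is absorbed into the divergence,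
  leaving \<open>s\<close> as the weight. The form is only semidefinite: it vanishes on fields whose
  momentum \<open>rho * \<phi>\<close> is divergence free.\<close>

definition aform :: "field \<Rightarrow> field \<Rightarrow> complex" where
  "aform \<phi> \<psi> = (\<integral>x. complex_of_real (s x) * (flux_div \<phi> x * cnj (flux_div \<psi> x)) \<partial>lborel)"

abbreviation pressure :: "field \<Rightarrow> pt \<Rightarrow> complex" where
  "pressure \<phi> \<equiv> \<lambda>y. - complex_of_real (s y) * flux_div \<phi> y"

lemma Aop_component: "Aop rho s \<phi> x $ j = pd j (pressure \<phi>) x"
  by (simp add: Aop_def flux_div_def)

lemma C0inf_supp:
  assumes "\<phi> \<in> C0inf U"
  shows "compact (tsupp \<phi>)" "closed (tsupp \<phi>)" "tsupp \<phi> \<subseteq> U"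
  using assms by (auto simp: C0inf_def tsupp_def)

lemma C0inf_ck: "\<phi> \<in> C0inf U \<Longrightarrow> ck n UNIV \<phi>"
  by (auto simp: C0inf_def intro: smooth_imp_ck)

lemma ck_flux:
  assumes "\<phi> \<in> C0inf U"
  shows "ck (Suc (Suc 0)) UNIV (\<lambda>z. complex_of_real (rho z) * \<phi> z $ i)"
proof (rule ck_zero_extension[OF U_open C0inf_supp(2,3)[OF assms]])
  have "ck (Suc (Suc 0)) U (\<lambda>z. complex_of_real (rho z))"
    using rho_ck by (intro ck_linear[OF bounded_linear_of_real U_open]) (simp add: numeral_2_eq_2 del: ck.simps)
  moreover have "ck (Suc (Suc 0)) U (\<lambda>z. \<phi> z $ i)"
    by (rule ck_linear[OF bounded_linear_vec_nth U_open ck_subset[OF C0inf_ck[OF assms]]]) simp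
  ultimately show "ck (Suc (Suc 0)) U (\<lambda>z. complex_of_real (rho z) * \<phi> z $ i)"
    by (rule ck_mult[OF U_open])
qed (simp add: outside_tsupp)

lemma flux_div_ck: "\<phi> \<in> C0inf U \<Longrightarrow> ck (Suc 0) UNIV (flux_div \<phi>)"
  unfolding flux_div_def[abs_def] by (intro ck_sum ck_pd ck_flux) auto

lemma flux_div_zero:
  assumes "\<phi> \<in> C0inf U" "x \<notin> tsupp \<phi>"
  shows "flux_div \<phi> x = 0"
  unfolding flux_div_def
  by (intro sum.neutral ballI pd_zero_outside(2)[OF C0inf_supp(2)[OF assms(1)]])
    (use assms in \<open>auto simp: outside_tsupp\<close>)

lemma pressure_ck:
  assumes "\<phi> \<in> C0inf U"
  shows "ck (Suc 0) UNIV (pressure \<phi>)"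
proof (rule ck_zero_extension[OF U_open C0inf_supp(2,3)[OF assms]])
  have "ck (Suc 0) U (\<lambda>z. - complex_of_real (s z))"
    using s_ck by (intro ck_linear[OF bounded_linear_minus[OF bounded_linear_of_real] U_open])
      (simp del: ck.simps)
  moreover have "ck (Suc 0) U (flux_div \<phi>)" by (rule ck_subset[OF flux_div_ck[OF assms]]) simp
  ultimately show "ck (Suc 0) U (pressure \<phi>)" by (rule ck_mult[OF U_open])
qed (simp add: flux_div_zero[OF assms])

lemma pressure_zero: "\<lbrakk>\<phi> \<in> C0inf U; x \<notin> tsupp \<phi>\<rbrakk> \<Longrightarrow> pressure \<phi> x = 0"
  by (simp add: flux_div_zero)

lemma compact_support_Hsp:
  assumes "continuous_on UNIV u" "compact K" "K \<subseteq> U" "\<And>x. x \<notin> K \<Longrightarrow> u x = 0"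
  shows "u \<in> Hsp U rho"
proof -
  have "continuous_on K rho" using ck_continuous[OF rho_ck] assms(3) by (rule continuous_on_subset)
  moreover have "continuous_on K u" using assms(1) by (rule continuous_on_subset) simp
  ultimately have "integrable lborel (\<lambda>x. indicator K x *\<^sub>R (rho x * (norm (u x))\<^sup>2))"
    using assms(2) by (intro borel_integrable_compact continuous_intros)
  moreover have "(\<lambda>x. indicator K x *\<^sub>R (rho x * (norm (u x))\<^sup>2)) = (\<lambda>x. indicator U x *\<^sub>R (rho x * (norm (u x))\<^sup>2))"
    using assms(3,4) by (auto simp: fun_eq_iff indicator_def)
  ultimately show ?thesis
    using borel_measurable_continuous_onI[OF assms(1)] by (simp add: Hsp_def set_integrable_def)
qed

lemma C0inf_Hsp: "\<phi> \<in> C0inf U \<Longrightarrow> \<phi> \<in> Hsp U rho"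
  by (rule compact_support_Hsp[OF ck_continuous[OF C0inf_ck] C0inf_supp(1,3)])
    (auto simp: outside_tsupp)

lemma Aop_Hsp:
  assumes \<phi>: "\<phi> \<in> C0inf U"
  shows "Aop rho s \<phi> \<in> Hsp U rho"
proof (rule compact_support_Hsp[OF _ C0inf_supp(1,3)[OF \<phi>]])
  have "continuous_on UNIV (\<lambda>x. \<chi> j. pd j (pressure \<phi>) x)"
    by (intro continuous_on_vec_lambda ck_continuous[OF ck_pd[OF pressure_ck[OF \<phi>]]])
  moreover have "(\<lambda>x. \<chi> j. pd j (pressure \<phi>) x) = Aop rho s \<phi>"
    by (simp add: fun_eq_iff vec_eq_iff Aop_component)
  ultimately show "continuous_on UNIV (Aop rho s \<phi>)" by (simp only:)
  show "Aop rho s \<phi> x = 0" if "x \<notin> tsupp \<phi>" for x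
    unfolding vec_eq_iff Aop_component
    using pd_zero_outside(2)[OF C0inf_supp(2)[OF \<phi>] pressure_zero[OF \<phi>] that] by simp
qed

lemma aform_integrable:
  assumes "\<phi> \<in> C0inf U" "\<psi> \<in> C0inf U"
  shows "integrable lborel (\<lambda>x. complex_of_real (s x) * (flux_div \<phi> x * cnj (flux_div \<psi> x)))"
proof -
  have "integrable lborel (\<lambda>x. - (pressure \<phi> x * cnj (flux_div \<psi> x)))"
    by (intro integrable_compact_support[OF _ C0inf_supp(1)[OF assms(1)]] continuous_on_minus
        continuous_on_mult continuous_on_cnj ck_continuous[OF pressure_ck] ck_continuous[OF flux_div_ck] assms)
      (simp add: flux_div_zero[OF assms(1)])
  then show ?thesis by (simp add: mult.assoc)
qed

text \<open>The weight and the test field combine to \<open>rho * \<psi>\<close>, on which the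
  gradient becomes a divergence; the sign from integration by parts cancels the one in
  \<open>pressure\<close>.\<close>

theorem Aop_aform:
  assumes \<phi>: "\<phi> \<in> C0inf U" and \<psi>: "\<psi> \<in> C0inf U"
  shows "Hinner U rho (Aop rho s \<phi>) \<psi> = aform \<phi> \<psi>"
proof -
  define g where "g j x = cnj (complex_of_real (rho x) * \<psi> x $ j)" for j x
  have g_ck: "ck (Suc 0) UNIV (g j)" for j
    unfolding g_def[abs_def] by (intro ck_linear[OF bounded_linear_cnj] ck_Suc_D[OF ck_flux[OF \<psi>]]) auto
  have pd_g: "pd j (g j) x = cnj (pd j (\<lambda>z. complex_of_real (rho z) * \<psi> z $ j) x)" for j x
    unfolding g_def[abs_def]
    by (intro pd_eqI has_pd_linear[OF bounded_linear_cnj] ck_has_pd[OF ck_flux[OF \<psi>]]) simp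
  have int: "integrable lborel (\<lambda>x. pd j (pressure \<phi>) x * g j x)"
      "integrable lborel (\<lambda>x. pressure \<phi> x * pd j (g j) x)" for j
    by (intro integrable_compact_support[OF _ C0inf_supp(1)[OF \<phi>]] continuous_on_mult
        ck_continuous[OF ck_pd[OF pressure_ck]] ck_continuous[OF pressure_ck] ck_continuous[OF g_ck]
        ck_continuous[OF ck_pd[OF g_ck]] \<phi>;
      use pd_zero_outside(2)[OF C0inf_supp(2)[OF \<phi>] pressure_zero[OF \<phi>]] flux_div_zero[OF \<phi>] in simp)+
  \<comment> \<open>The restriction to \<open>U\<close> disappears because \<open>rho\<close>
    vanishes outside.\<close>
  have "Hinner U rho (Aop rho s \<phi>) \<psi> = (\<integral>x. (\<Sum>j\<in>UNIV. pd j (pressure \<phi>) x * g j x) \<partial>lborel)"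
    unfolding Hinner_def set_lebesgue_integral_def
    by (rule Bochner_Integration.integral_cong)
      (auto simp: indicator_def cinner_def Aop_component g_def rho_outside sum_distrib_left algebra_simps)
  also have "\<dots> = (\<Sum>j\<in>UNIV. \<integral>x. pd j (pressure \<phi>) x * g j x \<partial>lborel)"
    by (rule Bochner_Integration.integral_sum) (rule int)
  also have "\<dots> = (\<Sum>j\<in>UNIV. - (\<integral>x. pressure \<phi> x * pd j (g j) x \<partial>lborel))"
    by (intro sum.cong refl integration_by_parts[OF pressure_ck[OF \<phi>] g_ck C0inf_supp(1)[OF \<phi>]]
        pressure_zero[OF \<phi>])
  also have "\<dots> = - (\<integral>x. (\<Sum>j\<in>UNIV. pressure \<phi> x * pd j (g j) x) \<partial>lborel)"
    by (simp only: Bochner_Integration.integral_sum[OF int(2)] sum_negf)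
  also have "\<dots> = (\<integral>x. - (\<Sum>j\<in>UNIV. pressure \<phi> x * pd j (g j) x) \<partial>lborel)" by simp
  also have "\<dots> = aform \<phi> \<psi>"
    unfolding aform_def
    by (rule Bochner_Integration.integral_cong)
      (auto simp: pd_g flux_div_def[of \<psi>] sum_distrib_left mult.assoc simp flip: sum_negf)
  finally show ?thesis .
qed

lemma flux_div_vlc:
  assumes "\<phi> \<in> C0inf U" "\<psi> \<in> C0inf U"
  shows "flux_div (vlc \<phi> c \<psi>) x = flux_div \<phi> x + c * flux_div \<psi> x"
proof -
  have "pd i (\<lambda>z. complex_of_real (rho z) * \<phi> z $ i + c * (complex_of_real (rho z) * \<psi> z $ i)) x
      = (pd i (\<lambda>z. complex_of_real (rho z) * \<phi> z $ i) x + c * pd i (\<lambda>z. complex_of_real (rho z) * \<psi> z $ i) x)" for i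
    by (intro pd_eqI has_pd_add has_pd_linear[OF bounded_linear_mult_right] ck_has_pd[OF ck_flux] assms) auto
  moreover have "(\<lambda>z. complex_of_real (rho z) * vlc \<phi> c \<psi> z $ i)
      = (\<lambda>z. complex_of_real (rho z) * \<phi> z $ i + c * (complex_of_real (rho z) * \<psi> z $ i))" for i
    by (simp add: vlc_def csc_def algebra_simps)
  ultimately show ?thesis
    by (simp add: flux_div_def sum.distrib sum_distrib_left)
qed

sublocale A: semi_inner_space "C0inf U" vlc aform
proof
  show "C0inf U \<noteq> {}" using C0inf_zero by blast
  fix \<phi> \<psi> \<theta> c assume \<phi>: "\<phi> \<in> C0inf U" and \<psi>: "\<psi> \<in> C0inf U"
  show "vlc \<phi> c \<psi> \<in> C0inf U" by (rule C0inf_vlc[OF \<phi> \<psi>])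
  show "aform \<phi> \<psi> = cnj (aform \<psi> \<phi>)"
    unfolding aform_def Bochner_Integration.integral_cnj[symmetric] by (simp add: mult.commute)
  have "aform \<phi> \<phi> = (\<integral>x. complex_of_real (s x * (cmod (flux_div \<phi> x))\<^sup>2) \<partial>lborel)"
    by (simp add: aform_def complex_norm_square del: of_real_power)
  also have "\<dots> = of_real (\<integral>x. s x * (cmod (flux_div \<phi> x))\<^sup>2 \<partial>lborel)" by (rule integral_complex_of_real)
  finally show "0 \<le> Re (aform \<phi> \<phi>)" using s_nonneg by simp
  assume \<theta>: "\<theta> \<in> C0inf U"
  have "aform (vlc \<phi> c \<psi>) \<theta> = (\<integral>x. complex_of_real (s x) * (flux_div \<phi> x * cnj (flux_div \<theta> x))
      + c * (complex_of_real (s x) * (flux_div \<psi> x * cnj (flux_div \<theta> x))) \<partial>lborel)"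
    by (simp add: aform_def flux_div_vlc[OF \<phi> \<psi>] algebra_simps)
  also have "\<dots> = aform \<phi> \<theta> + c * aform \<psi> \<theta>"
    unfolding aform_def
    by (subst Bochner_Integration.integral_add)
      (auto intro!: integrable_mult_right aform_integrable \<phi> \<psi> \<theta>)
  finally show "aform (vlc \<phi> c \<psi>) \<theta> = aform \<phi> \<theta> + c * aform \<psi> \<theta>" .
qed

lemma Hinner_Aop_right:
  "\<lbrakk>\<phi> \<in> C0inf U; \<psi> \<in> C0inf U\<rbrakk> \<Longrightarrow> Hinner U rho \<phi> (Aop rho s \<psi>) = aform \<phi> \<psi>"
  using H.G_herm[OF C0inf_Hsp Aop_Hsp, of \<phi> \<psi>] A.G_herm[of \<phi> \<psi>] by (simp add: Aop_aform)

lemma C0inf_diff: "\<lbrakk>\<phi> \<in> C0inf U; \<psi> \<in> C0inf U\<rbrakk> \<Longrightarrow> (\<lambda>x. \<phi> x - \<psi> x) \<in> C0inf U"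
  using C0inf_vlc[of \<phi> U \<psi> "-1"] by (simp add: vlc_minus)

text \<open>The weak equation may be tested only with test fields, not with \<open>\<xi>\<close>.
  For approximants, \<open><f, \<phi> n>\<close> equals the limit over \<open>m\<close> of
  \<open>aform (\<phi> m) (\<phi> n)\<close>, and the energy Cauchy property makes this close to
  \<open>aform (\<phi> n) (\<phi> n) \<ge> 0\<close> for large \<open>n\<close>.\<close>

lemma Lgraph_nonneg:
  assumes L: "Lgraph U rho s \<xi> f"
  obtains a where "Hinner U rho f \<xi> = complex_of_real a" "0 \<le> a"
proof -
  have \<xi>: "\<xi> \<in> Hsp U rho" and f: "f \<in> Hsp U rho"
    and weak: "\<And>\<psi>. \<psi> \<in> C0inf U \<Longrightarrow> Hinner U rho \<xi> (Aop rho s \<psi>) = Hinner U rho f \<psi>"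
    using L by (auto simp: Lgraph_def formdom_def)
  obtain \<phi> where \<phi>: "\<And>n. \<phi> n \<in> C0inf U"
    and lim: "(\<lambda>n. Hnorm U rho (\<lambda>x. \<phi> n x - \<xi> x)) \<longlonglongrightarrow> 0"
    and Cau: "\<And>e. e > 0 \<Longrightarrow> \<exists>N. \<forall>m\<ge>N. \<forall>n\<ge>N.
        Re (Hinner U rho (Aop rho s (\<lambda>x. \<phi> n x - \<phi> m x)) (\<lambda>x. \<phi> n x - \<phi> m x)) < e"
    using L unfolding Lgraph_def formdom_def by blast
  have Cauchy: "\<exists>N. \<forall>m\<ge>N. \<forall>n\<ge>N. A.nrm (\<lambda>x. \<phi> m x - \<phi> n x) < e" if "e > 0" for e
  proof -
    have "e\<^sup>2 > 0" using that by simp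
    from Cau[OF this] obtain N where N: "\<And>m n. \<lbrakk>m \<ge> N; n \<ge> N\<rbrakk> \<Longrightarrow>
        Re (Hinner U rho (Aop rho s (\<lambda>x. \<phi> n x - \<phi> m x)) (\<lambda>x. \<phi> n x - \<phi> m x)) < e\<^sup>2"
      by blast
    have "A.nrm (\<lambda>x. \<phi> m x - \<phi> n x) < e" if "m \<ge> N" "n \<ge> N" for m n
      using N[OF that(2,1)] \<open>e > 0\<close> by (simp add: A.nrm_def Aop_aform C0inf_diff \<phi> real_less_lsqrt)
    then show ?thesis by blast
  qed
  define c where "c n = Hinner U rho f (\<phi> n)" for n
  define b where "b n = aform (\<phi> n) (\<phi> n)" for n
  have c_lim: "(\<lambda>n. c n) \<longlonglongrightarrow> Hinner U rho f \<xi>"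
  proof -
    have "(\<lambda>n. cnj (Hinner U rho (\<phi> n) f)) \<longlonglongrightarrow> cnj (Hinner U rho \<xi> f)"
      by (intro tendsto_intros Hinner_tendsto_left C0inf_Hsp \<phi> \<xi> f lim)
    then show ?thesis using H.G_herm[OF f \<xi>] H.G_herm[OF f C0inf_Hsp[OF \<phi>]] by (simp add: c_def)
  qed
  obtain N1 where N1: "\<And>n. n \<ge> N1 \<Longrightarrow> A.nrm (\<lambda>x. \<phi> n x - \<phi> N1 x) < 1"
    using Cauchy[of 1] by auto
  \<comment> \<open>Bounds the energy norms of the tail of the sequence; being at least 1, it may be
    divided by.\<close>
  define B where "B = 1 + A.nrm (\<phi> N1)"
  have B1: "B \<ge> 1" using A.nrm_nonneg[OF \<phi>] by (simp add: B_def)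
  have B: "A.nrm (\<phi> n) \<le> B" if "n \<ge> N1" for n
  proof -
    have "vlc (\<lambda>x. \<phi> n x - \<phi> N1 x) 1 (\<phi> N1) = \<phi> n" by (simp add: vlc_def csc_simps)
    then have "A.nrm (\<phi> n) \<le> A.nrm (\<lambda>x. \<phi> n x - \<phi> N1 x) + A.nrm (\<phi> N1)"
      using A.nrm_triangle[OF C0inf_diff[OF \<phi> \<phi>] \<phi>, of n N1 1 N1] by simp
    then show ?thesis using N1[OF that] by (simp add: B_def)
  qed
  have "(\<lambda>n. c n - b n) \<longlonglongrightarrow> 0"
  proof (rule LIMSEQ_I)
    fix e :: real assume e: "e > 0"
    then have "e / (2 * B) > 0" using B1 by simp
    from Cauchy[OF this] obtain N where
      N: "\<And>m n. \<lbrakk>m \<ge> N; n \<ge> N\<rbrakk> \<Longrightarrow> A.nrm (\<lambda>x. \<phi> m x - \<phi> n x) < e / (2 * B)" by blast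
    show "\<exists>no. \<forall>n\<ge>no. norm (c n - b n - 0) < e"
    proof (intro exI allI impI)
      fix n assume n: "n \<ge> max N N1"
      \<comment> \<open>With \<open>n\<close> fixed, the weak equation presents \<open>c n\<close>
        as a limit in \<open>m\<close>; the bound \<open>e / 2\<close> survives this limit, and
        strictness is recovered afterwards.\<close>
      have "(\<lambda>m. Hinner U rho (\<phi> m) (Aop rho s (\<phi> n))) \<longlonglongrightarrow> c n"
        unfolding c_def weak[OF \<phi>, symmetric]
        by (intro Hinner_tendsto_left C0inf_Hsp Aop_Hsp \<phi> \<xi> lim)
      then have "(\<lambda>m. norm (aform (\<phi> m) (\<phi> n) - b n)) \<longlonglongrightarrow> norm (c n - b n)"
        by (intro tendsto_intros) (simp add: Hinner_Aop_right \<phi>)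
      moreover have "norm (aform (\<phi> m) (\<phi> n) - b n) \<le> e / 2" if m: "m \<ge> N" for m
      proof -
        have "aform (\<phi> m) (\<phi> n) - b n = aform (\<lambda>x. \<phi> m x - \<phi> n x) (\<phi> n)"
          using A.G_left[OF \<phi> \<phi> \<phi>, of m "-1" n n] by (simp add: vlc_minus b_def)
        then have "norm (aform (\<phi> m) (\<phi> n) - b n) \<le> A.nrm (\<lambda>x. \<phi> m x - \<phi> n x) * A.nrm (\<phi> n)"
          using A.Cauchy_Schwarz[OF C0inf_diff[OF \<phi> \<phi>] \<phi>, of m n n] by simp
        also have "\<dots> \<le> e / (2 * B) * B"
          using N[OF m, of n] B[of n] n A.nrm_nonneg[OF \<phi>] A.nrm_nonneg[OF C0inf_diff[OF \<phi> \<phi>]] e B1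
          by (intro mult_mono) auto
        finally show ?thesis using B1 by simp
      qed
      ultimately have "norm (c n - b n) \<le> e / 2"
        by (intro LIMSEQ_le_const2) auto
      then show "norm (c n - b n - 0) < e" using e by simp
    qed
  qed
  from tendsto_diff[OF c_lim this] have b_lim: "b \<longlonglongrightarrow> Hinner U rho f \<xi>" by simp
  have "Im (Hinner U rho f \<xi>) = 0"
    using tendsto_Im[OF b_lim] by (simp add: b_def A.G_self \<phi> LIMSEQ_const_iff)
  moreover have "0 \<le> Re (Hinner U rho f \<xi>)"
    by (rule LIMSEQ_le_const[OF tendsto_Re[OF b_lim]]) (auto simp: b_def A.G_nonneg \<phi>)
  ultimately show ?thesis using that[of "Re (Hinner U rho f \<xi>)"] by (simp add: complex_eq_iff)
qed

section \<open>The rotation term and the pencil\<close>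

lemma Hinner_Jstar_real:
  assumes "u \<in> Hsp U rho"
  shows "Hinner U rho (\<lambda>x. Jstar (u x)) u = of_real (Re (Hinner U rho (\<lambda>x. Jstar (u x)) u))"
proof -
  have "Hinner U rho (\<lambda>x. Jstar (u x)) u = Hinner U rho u (\<lambda>x. Jstar (u x))"
    by (simp add: Hinner_def Jstar_symmetric)
  also have "\<dots> = cnj (Hinner U rho (\<lambda>x. Jstar (u x)) u)" using assms by (intro H.G_herm Hsp_Jstar)
  finally show ?thesis by (simp add: complex_eq_iff)
qed

lemma Hnorm_Jstar_le: "u \<in> Hsp U rho \<Longrightarrow> Hnorm U rho (\<lambda>x. Jstar (u x)) \<le> Hnorm U rho u"
proof -
  assume u: "u \<in> Hsp U rho"
  have "(LINT x:U|lborel. rho x * (norm (Jstar (u x)))\<^sup>2) \<le> (LINT x:U|lborel. rho x * (norm (u x))\<^sup>2)"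
    by (rule set_integral_mono)
      (use u Hsp_Jstar[OF u] rho_pos norm_Jstar_le in \<open>auto simp: Hsp_def power_mono intro!: mult_left_mono less_imp_le\<close>)
  then show ?thesis by (simp add: Hnorm_def)
qed

lemma Hnorm_nonneg: "0 \<le> Hnorm U rho u"
  by (simp add: Hnorm_def Hinner_self_nonneg)

text \<open>The argument \<open>f\<close> stands for the image of \<open>\<xi>\<close> under the
  Friedrichs extension, which is available as a graph and not as a function.\<close>

definition pencil :: "real \<Rightarrow> complex \<Rightarrow> field \<Rightarrow> field \<Rightarrow> field" where
  "pencil Om \<sigma> \<xi> f = (\<lambda>x. csc (- (\<sigma>\<^sup>2)) (\<xi> x) + csc (2 * complex_of_real Om * \<sigma>) (Jstar (\<xi> x)) + f x)"

lemma pencil_vlc: "pencil Om \<sigma> \<xi> f = vlc (vlc f (- (\<sigma>\<^sup>2)) \<xi>) (2 * complex_of_real Om * \<sigma>) (\<lambda>x. Jstar (\<xi> x))"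
  by (simp add: pencil_def vlc_def fun_eq_iff algebra_simps)

lemma pencil_Hsp: "\<lbrakk>\<xi> \<in> Hsp U rho; f \<in> Hsp U rho\<rbrakk> \<Longrightarrow> pencil Om \<sigma> \<xi> f \<in> Hsp U rho"
  unfolding pencil_vlc by (intro Hsp_vlc Hsp_Jstar)

lemma Hinner_pencil:
  "\<lbrakk>\<xi> \<in> Hsp U rho; f \<in> Hsp U rho; u \<in> Hsp U rho\<rbrakk> \<Longrightarrow> Hinner U rho (pencil Om \<sigma> \<xi> f) u
    = - \<sigma>\<^sup>2 * Hinner U rho \<xi> u + 2 * Om * \<sigma> * Hinner U rho (\<lambda>x. Jstar (\<xi> x)) u + Hinner U rho f u"
  unfolding pencil_vlc by (simp add: H.G_left Hsp_vlc Hsp_Jstar)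

text \<open>Pairing with \<open>\<xi>\<close> and dropping the nonnegative \<open><f, \<xi>>\<close>
  leaves \<open>|Im \<sigma>| * |\<sigma>|^2 * n^2 \<le> |\<sigma>| * p * n\<close>, with
  \<open>n\<close> the norm of \<open>\<xi>\<close> and \<open>p\<close> that of the pencil; the
  constant is what remains after cancelling \<open>|\<sigma>| * n\<close>.\<close>

lemma pencil_lower_bound:
  assumes L: "Lgraph U rho s \<xi> f" and \<sigma>: "Im \<sigma> \<noteq> 0"
  shows "Hnorm U rho \<xi> \<le> 1 / (cmod \<sigma> * \<bar>Im \<sigma>\<bar>) * Hnorm U rho (pencil Om \<sigma> \<xi> f)"
proof -
  have \<xi>: "\<xi> \<in> Hsp U rho" and f: "f \<in> Hsp U rho" using L by (auto simp: Lgraph_def formdom_def)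
  have \<sigma>0: "cmod \<sigma> > 0" using \<sigma> by auto
  obtain a where a: "Hinner U rho f \<xi> = of_real a" "0 \<le> a" using Lgraph_nonneg[OF L] .
  obtain j where j: "Hinner U rho (\<lambda>x. Jstar (\<xi> x)) \<xi> = complex_of_real j"
    using Hinner_Jstar_real[OF \<xi>] by blast
  let ?n = "Hnorm U rho \<xi>" and ?P = "pencil Om \<sigma> \<xi> f"
  have "Im (cnj \<sigma> * Hinner U rho ?P \<xi>) = - Im \<sigma> * ((cmod \<sigma>)\<^sup>2 * ?n\<^sup>2 + a)"
    using Im_pencil_value[of \<sigma> "?n\<^sup>2" Om j a] H.G_self[OF \<xi>]
    by (simp add: Hinner_pencil \<xi> f a j nrm_eq_Hnorm)
  then have "\<bar>Im \<sigma>\<bar> * ((cmod \<sigma>)\<^sup>2 * ?n\<^sup>2 + a) = \<bar>Im (cnj \<sigma> * Hinner U rho ?P \<xi>)\<bar>"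
    using a(2) by (simp add: abs_mult)
  also have "\<dots> \<le> cmod (cnj \<sigma> * Hinner U rho ?P \<xi>)" by (rule abs_Im_le_cmod)
  also have "\<dots> \<le> cmod \<sigma> * (Hnorm U rho ?P * ?n)"
    using H.Cauchy_Schwarz[OF pencil_Hsp[OF \<xi> f] \<xi>]
    by (simp add: norm_mult nrm_eq_Hnorm mult_left_mono)
  finally have "\<bar>Im \<sigma>\<bar> * ((cmod \<sigma>)\<^sup>2 * ?n\<^sup>2 + a) \<le> cmod \<sigma> * (Hnorm U rho ?P * ?n)" .
  moreover have "\<bar>Im \<sigma>\<bar> * ((cmod \<sigma>)\<^sup>2 * ?n\<^sup>2) \<le> \<bar>Im \<sigma>\<bar> * ((cmod \<sigma>)\<^sup>2 * ?n\<^sup>2 + a)"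
    using a(2) by (intro mult_left_mono) auto
  ultimately have "(cmod \<sigma> * ?n) * (\<bar>Im \<sigma>\<bar> * cmod \<sigma> * ?n) \<le> (cmod \<sigma> * ?n) * Hnorm U rho ?P"
    by (simp add: power2_eq_square mult_ac)
  then have "\<bar>Im \<sigma>\<bar> * cmod \<sigma> * ?n \<le> Hnorm U rho ?P"
    using \<sigma>0 Hnorm_nonneg[of \<xi>] Hnorm_nonneg[of ?P] by (cases "?n = 0") auto
  then show ?thesis using \<sigma> \<sigma>0 by (simp add: field_simps)
qed

lemma energy_space:
  assumes "k \<ge> 0"
  shows "semi_inner_space (C0inf U) vlc (\<lambda>\<phi> \<psi>. Hinner U rho \<phi> \<psi> + complex_of_real k * aform \<phi> \<psi>)"
proof
  show "C0inf U \<noteq> {}" by (rule A.nonempty)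
  fix \<phi> \<psi> \<theta> c assume \<phi>: "\<phi> \<in> C0inf U" and \<psi>: "\<psi> \<in> C0inf U"
  show "vlc \<phi> c \<psi> \<in> C0inf U" by (rule C0inf_vlc[OF \<phi> \<psi>])
  show "Hinner U rho \<phi> \<psi> + complex_of_real k * aform \<phi> \<psi> = cnj (Hinner U rho \<psi> \<phi> + complex_of_real k * aform \<psi> \<phi>)"
    using H.G_herm[OF C0inf_Hsp[OF \<phi>] C0inf_Hsp[OF \<psi>]] A.G_herm[OF \<phi> \<psi>] by simp
  show "0 \<le> Re (Hinner U rho \<phi> \<phi> + complex_of_real k * aform \<phi> \<phi>)"
    using H.G_nonneg[OF C0inf_Hsp[OF \<phi>]] A.G_nonneg[OF \<phi>] assms by simp
  assume \<theta>: "\<theta> \<in> C0inf U"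
  show "Hinner U rho (vlc \<phi> c \<psi>) \<theta> + complex_of_real k * aform (vlc \<phi> c \<psi>) \<theta>
      = Hinner U rho \<phi> \<theta> + complex_of_real k * aform \<phi> \<theta> + c * (Hinner U rho \<psi> \<theta> + complex_of_real k * aform \<psi> \<theta>)"
    by (simp add: H.G_left A.G_left C0inf_Hsp \<phi> \<psi> \<theta> algebra_simps)
qed

text \<open>The energy norm dominates the \<open>L^2\<close> norm and, up to the factor
  \<open>|\<sigma>|\<close>, the form of the operator. Energy Cauchy approximants therefore yield
  both the limit and its membership in the form domain.\<close>

lemma pencil_surjective:
  assumes h: "h \<in> Hsp U rho" and \<sigma>: "Im \<sigma> \<noteq> 0"
  obtains \<xi> f where "Lgraph U rho s \<xi> f" "pencil Om \<sigma> \<xi> f = h"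
proof -
  have \<sigma>0: "cmod \<sigma> > 0" using \<sigma> by auto
  define k where "k = 1 / (cmod \<sigma>)\<^sup>2"
  have k: "k > 0" using \<sigma>0 by (simp add: k_def)
  define G where "G \<phi> \<psi> = Hinner U rho \<phi> \<psi> + complex_of_real k * aform \<phi> \<psi>" for \<phi> \<psi>
  interpret V: semi_inner_space "C0inf U" vlc G
    using energy_space[of k] k unfolding G_def[abs_def] by simp
  define pf where "pf \<phi> \<psi> = - \<sigma>\<^sup>2 * Hinner U rho \<phi> \<psi> + 2 * Om * \<sigma> * Hinner U rho (\<lambda>x. Jstar (\<phi> x)) \<psi> + aform \<phi> \<psi>" for \<phi> \<psi>
  \<comment> \<open>The factor \<open>\<i>\<close> turns the imaginary part of
    \<open>cnj \<sigma> * pf\<close> into a real part, and the denominator normalises it: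
    \<open>Re (B \<phi> \<phi>)\<close> equals the squared energy norm with weight \<open>k\<close>,
    for either sign of \<open>Im \<sigma>\<close>.\<close>
  define \<mu> where "\<mu> = \<i> * cnj \<sigma> / of_real (Im \<sigma> * (cmod \<sigma>)\<^sup>2)"
  have \<mu>: "\<mu> \<noteq> 0" using \<sigma> \<sigma>0 by (simp add: \<mu>_def)
  define B where "B \<phi> \<psi> = \<mu> * pf \<phi> \<psi>" for \<phi> \<psi>
  have nV: "(V.nrm \<phi>)\<^sup>2 = (Hnorm U rho \<phi>)\<^sup>2 + k * (A.nrm \<phi>)\<^sup>2" if "\<phi> \<in> C0inf U" for \<phi>
    using V.nrm_sq[OF that] H.nrm_sq[OF C0inf_Hsp[OF that]] A.nrm_sq[OF that] by (simp add: G_def nrm_eq_Hnorm)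
  have HV: "Hnorm U rho \<phi> \<le> V.nrm \<phi>" if "\<phi> \<in> C0inf U" for \<phi>
    by (rule power2_le_imp_le) (use nV[OF that] V.nrm_nonneg[OF that] k in simp_all)
  have AV: "A.nrm \<phi> \<le> cmod \<sigma> * V.nrm \<phi>" if "\<phi> \<in> C0inf U" for \<phi>
  proof (rule power2_le_imp_le)
    have "(A.nrm \<phi>)\<^sup>2 = (cmod \<sigma>)\<^sup>2 * (k * (A.nrm \<phi>)\<^sup>2)" using \<sigma>0 by (simp add: k_def)
    also have "\<dots> \<le> (cmod \<sigma>)\<^sup>2 * (V.nrm \<phi>)\<^sup>2" using nV[OF that] by (intro mult_left_mono) auto
    finally show "(A.nrm \<phi>)\<^sup>2 \<le> (cmod \<sigma> * V.nrm \<phi>)\<^sup>2" by (simp add: power_mult_distrib)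
  qed (use V.nrm_nonneg[OF that] in simp)
  have J_vlc: "(\<lambda>x. Jstar (vlc \<phi> c \<psi> x)) = vlc (\<lambda>x. Jstar (\<phi> x)) c (\<lambda>x. Jstar (\<psi> x))" for \<phi> \<psi> c
    by (simp add: vlc_def Jstar_add Jstar_csc)
  have B_left: "B (vlc \<phi> c \<psi>) \<theta> = B \<phi> \<theta> + c * B \<psi> \<theta>"
    if "\<phi> \<in> C0inf U" "\<psi> \<in> C0inf U" "\<theta> \<in> C0inf U" for \<phi> \<psi> \<theta> c
    using that by (simp add: B_def pf_def J_vlc H.G_left A.G_left C0inf_Hsp Hsp_Jstar algebra_simps)
  have B_right: "V.antilinear (B \<phi>)" if "\<phi> \<in> C0inf U" for \<phi>
    using that unfolding V.antilinear_def B_def pf_def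
    by (simp add: H.G_right A.G_right C0inf_Hsp Hsp_Jstar algebra_simps)
  have coercive: "(V.nrm \<phi>)\<^sup>2 \<le> Re (B \<phi> \<phi>)" if \<phi>: "\<phi> \<in> C0inf U" for \<phi>
  proof -
    obtain j where j: "Hinner U rho (\<lambda>x. Jstar (\<phi> x)) \<phi> = complex_of_real j"
      using Hinner_Jstar_real[OF C0inf_Hsp[OF \<phi>]] by blast
    have "Im (cnj \<sigma> * pf \<phi> \<phi>) = - Im \<sigma> * ((cmod \<sigma>)\<^sup>2 * (Hnorm U rho \<phi>)\<^sup>2 + (A.nrm \<phi>)\<^sup>2)"
      using Im_pencil_value[of \<sigma> "(Hnorm U rho \<phi>)\<^sup>2" Om j "(A.nrm \<phi>)\<^sup>2"]
        H.G_self[OF C0inf_Hsp[OF \<phi>]] A.G_self[OF \<phi>]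
      by (simp add: pf_def j nrm_eq_Hnorm)
    moreover have "B \<phi> \<phi> = \<i> * (cnj \<sigma> * pf \<phi> \<phi>) / of_real (Im \<sigma> * (cmod \<sigma>)\<^sup>2)"
      by (simp add: B_def \<mu>_def mult.assoc)
    then have "Re (B \<phi> \<phi>) = - Im (cnj \<sigma> * pf \<phi> \<phi>) / (Im \<sigma> * (cmod \<sigma>)\<^sup>2)"
      by (simp only: Re_divide_of_real Re_i_times)
    ultimately have "Re (B \<phi> \<phi>)
        = - (- Im \<sigma> * ((cmod \<sigma>)\<^sup>2 * (Hnorm U rho \<phi>)\<^sup>2 + (A.nrm \<phi>)\<^sup>2)) / (Im \<sigma> * (cmod \<sigma>)\<^sup>2)"
      by (simp only:)
    moreover have "- (- b * (c * n + a)) / (b * c) = n + 1 / c * a" if "b \<noteq> 0" "c \<noteq> 0" for a b c n :: real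
      using that by (simp add: field_simps)
    ultimately have "Re (B \<phi> \<phi>) = (Hnorm U rho \<phi>)\<^sup>2 + k * (A.nrm \<phi>)\<^sup>2"
      using \<sigma> \<sigma>0 by (simp add: k_def)
    then show ?thesis using nV[OF \<phi>] by simp
  qed
  \<comment> \<open>One summand per term of the pencil: \<open>J\<^sub>\<star>\<close> has norm at
    most 1, and the last \<open>|\<sigma>|^2\<close> arises from bounding the form norm by
    \<open>|\<sigma>|\<close> times the energy norm in both arguments.\<close>
  define M where "M = cmod \<mu> * ((cmod \<sigma>)\<^sup>2 + 2 * \<bar>Om\<bar> * cmod \<sigma> + (cmod \<sigma>)\<^sup>2)"
  have bounded: "cmod (B \<phi> \<psi>) \<le> M * V.nrm \<phi> * V.nrm \<psi>" if \<phi>: "\<phi> \<in> C0inf U" and \<psi>: "\<psi> \<in> C0inf U" for \<phi> \<psi>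
  proof -
    let ?N = "V.nrm \<phi> * V.nrm \<psi>"
    note nn = V.nrm_nonneg[OF \<phi>] V.nrm_nonneg[OF \<psi>]
    have 1: "cmod (Hinner U rho \<phi> \<psi>) \<le> ?N"
      using H.Cauchy_Schwarz[OF C0inf_Hsp[OF \<phi>] C0inf_Hsp[OF \<psi>]] mult_mono[OF HV[OF \<phi>] HV[OF \<psi>]] nn
        Hnorm_nonneg by (simp add: nrm_eq_Hnorm)
    have "Hnorm U rho (\<lambda>x. Jstar (\<phi> x)) \<le> V.nrm \<phi>"
      using Hnorm_Jstar_le[OF C0inf_Hsp[OF \<phi>]] HV[OF \<phi>] by simp
    then have 2: "cmod (Hinner U rho (\<lambda>x. Jstar (\<phi> x)) \<psi>) \<le> ?N"
      using H.Cauchy_Schwarz[OF Hsp_Jstar[OF C0inf_Hsp[OF \<phi>]] C0inf_Hsp[OF \<psi>]] mult_mono[OF _ HV[OF \<psi>]] nn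
        Hnorm_nonneg by (fastforce simp: nrm_eq_Hnorm)
    have "cmod (aform \<phi> \<psi>) \<le> A.nrm \<phi> * A.nrm \<psi>" by (rule A.Cauchy_Schwarz[OF \<phi> \<psi>])
    also have "\<dots> \<le> (cmod \<sigma> * V.nrm \<phi>) * (cmod \<sigma> * V.nrm \<psi>)"
      using AV[OF \<phi>] AV[OF \<psi>] A.nrm_nonneg[OF \<psi>] nn by (intro mult_mono) auto
    finally have 3: "cmod (aform \<phi> \<psi>) \<le> (cmod \<sigma>)\<^sup>2 * ?N" by (simp add: power2_eq_square mult_ac)
    have "cmod (pf \<phi> \<psi>) \<le> cmod (- \<sigma>\<^sup>2 * Hinner U rho \<phi> \<psi>)
        + cmod (2 * Om * \<sigma> * Hinner U rho (\<lambda>x. Jstar (\<phi> x)) \<psi>) + cmod (aform \<phi> \<psi>)"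
      unfolding pf_def by (intro order_trans[OF norm_triangle_ineq] add_mono order_refl norm_triangle_ineq)
    also have "\<dots> \<le> (cmod \<sigma>)\<^sup>2 * ?N + (2 * \<bar>Om\<bar> * cmod \<sigma>) * ?N + (cmod \<sigma>)\<^sup>2 * ?N"
      using 1 2 3 by (intro add_mono) (auto simp: norm_mult norm_power mult_left_mono)
    also have "\<dots> = ((cmod \<sigma>)\<^sup>2 + 2 * \<bar>Om\<bar> * cmod \<sigma> + (cmod \<sigma>)\<^sup>2) * ?N" by (simp add: algebra_simps)
    finally have "cmod \<mu> * cmod (pf \<phi> \<psi>) \<le> cmod \<mu> * (((cmod \<sigma>)\<^sup>2 + 2 * \<bar>Om\<bar> * cmod \<sigma> + (cmod \<sigma>)\<^sup>2) * ?N)"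
      by (rule mult_left_mono) simp
    then show ?thesis by (simp add: B_def M_def norm_mult mult.assoc)
  qed
  define l where "l \<psi> = \<mu> * Hinner U rho h \<psi>" for \<psi>
  have l_anti: "V.antilinear l"
    unfolding V.antilinear_def l_def by (simp add: H.G_right C0inf_Hsp h algebra_simps)
  have l_bd: "cmod (l \<psi>) \<le> (cmod \<mu> * Hnorm U rho h) * V.nrm \<psi>" if \<psi>: "\<psi> \<in> C0inf U" for \<psi>
  proof -
    have "cmod (Hinner U rho h \<psi>) \<le> Hnorm U rho h * Hnorm U rho \<psi>"
      using H.Cauchy_Schwarz[OF h C0inf_Hsp[OF \<psi>]] by (simp add: nrm_eq_Hnorm)
    also have "\<dots> \<le> Hnorm U rho h * V.nrm \<psi>" using HV[OF \<psi>] Hnorm_nonneg by (intro mult_left_mono)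
    finally show ?thesis by (simp add: l_def norm_mult mult.assoc mult_left_mono)
  qed
  have "\<exists>\<eta>\<in>C0inf U. \<forall>\<psi>\<in>C0inf U. cmod (B \<eta> \<psi> - l \<psi>) \<le> 1 / real (Suc n) * V.nrm \<psi>" for n
    by (rule V.approximate_Lax_Milgram[OF l_anti l_bd B_left B_right bounded coercive, of "1 / real (Suc n)"]) auto
  then obtain \<phi> where \<phi>: "\<And>n. \<phi> n \<in> C0inf U"
    and app: "\<And>n \<psi>. \<psi> \<in> C0inf U \<Longrightarrow> cmod (B (\<phi> n) \<psi> - l \<psi>) \<le> 1 / real (Suc n) * V.nrm \<psi>" by metis
  have VCauchy: "\<exists>N. \<forall>m\<ge>N. \<forall>n\<ge>N. V.nrm (\<lambda>x. \<phi> m x - \<phi> n x) < e" if e: "e > 0" for e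
  proof -
    obtain N where N: "1 / real (Suc N) < e / 2" using e nat_approx_posE[of "e/2"] by auto
    have "V.nrm (\<lambda>x. \<phi> m x - \<phi> n x) < e" if "m \<ge> N" "n \<ge> N" for m n
    proof -
      let ?d = "\<lambda>x. \<phi> m x - \<phi> n x"
      have d: "?d \<in> C0inf U" by (rule C0inf_diff[OF \<phi> \<phi>])
      \<comment> \<open>The inhomogeneity cancels, so coercivity bounds the difference of two
        approximate solutions by the sum of their residuals.\<close>
      have "B ?d ?d = (B (\<phi> m) ?d - l ?d) - (B (\<phi> n) ?d - l ?d)"
        using B_left[OF \<phi> \<phi> d, of m "-1" n] by (simp add: vlc_minus)
      then have "cmod (B ?d ?d) \<le> 1 / real (Suc m) * V.nrm ?d + 1 / real (Suc n) * V.nrm ?d"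
        using app[OF d, of m] app[OF d, of n] norm_triangle_ineq4[of "B (\<phi> m) ?d - l ?d" "B (\<phi> n) ?d - l ?d"] by simp
      also have "\<dots> = (1 / real (Suc m) + 1 / real (Suc n)) * V.nrm ?d" by (simp add: algebra_simps)
      also have "\<dots> \<le> (1 / real (Suc N) + 1 / real (Suc N)) * V.nrm ?d"
        using that by (intro mult_right_mono add_mono V.nrm_nonneg[OF d]) (auto intro!: divide_left_mono)
      finally have "V.nrm ?d * V.nrm ?d \<le> (2 / real (Suc N)) * V.nrm ?d"
        using coercive[OF d] complex_Re_le_cmod[of "B ?d ?d"] by (simp add: power2_eq_square)
      then have "V.nrm ?d \<le> 2 / real (Suc N)"
      proof (cases "V.nrm ?d = 0")
        case False
        then have "0 < V.nrm ?d" using V.nrm_nonneg[OF d] by simp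
        then show ?thesis by (rule mult_right_le_imp_le[rotated]) fact
      qed simp
      then show ?thesis using N by simp
    qed
    then show ?thesis by blast
  qed
  have HCauchy: "\<exists>N. \<forall>m\<ge>N. \<forall>n\<ge>N. Hnorm U rho (\<lambda>x. \<phi> m x - \<phi> n x) < e" if "e > 0" for e
    using VCauchy[OF that] HV[OF C0inf_diff[OF \<phi> \<phi>]] by (meson le_less_trans)
  obtain \<xi> where \<xi>: "\<xi> \<in> Hsp U rho" and lim: "(\<lambda>n. Hnorm U rho (\<lambda>x. \<phi> n x - \<xi> x)) \<longlonglongrightarrow> 0"
    using Hsp_complete[OF C0inf_Hsp[OF \<phi>] HCauchy] by blast
  have "\<xi> \<in> formdom U rho s"
    unfolding formdom_def
  proof (intro CollectI conjI exI[of _ \<phi>] allI impI)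
    fix e :: real assume e: "e > 0"
    \<comment> \<open>The square root passes from the form to its norm, and
      \<open>|\<sigma>|\<close> from that norm to the energy norm.\<close>
    then have "sqrt e / cmod \<sigma> > 0" using \<sigma>0 by simp
    from VCauchy[OF this] obtain N where
      N: "\<And>m n. \<lbrakk>m \<ge> N; n \<ge> N\<rbrakk> \<Longrightarrow> V.nrm (\<lambda>x. \<phi> m x - \<phi> n x) < sqrt e / cmod \<sigma>" by blast
    show "\<exists>N. \<forall>m\<ge>N. \<forall>n\<ge>N.
        Re (Hinner U rho (Aop rho s (\<lambda>x. \<phi> n x - \<phi> m x)) (\<lambda>x. \<phi> n x - \<phi> m x)) < e"
    proof (intro exI allI impI)
      fix m n assume "N \<le> m" "N \<le> n"
      then have "A.nrm (\<lambda>x. \<phi> n x - \<phi> m x) < sqrt e"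
        using N[of n m] AV[OF C0inf_diff[OF \<phi> \<phi>], of n m] \<sigma>0 by (simp add: field_simps)
      then show "Re (Hinner U rho (Aop rho s (\<lambda>x. \<phi> n x - \<phi> m x)) (\<lambda>x. \<phi> n x - \<phi> m x)) < e"
        by (simp add: Aop_aform C0inf_diff \<phi> A.nrm_def)
    qed
  qed (use \<phi> \<xi> lim in auto)
  \<comment> \<open>The pencil equation solved for \<open>f\<close>, that is
    \<open>h + \<sigma>^2 \<xi> - 2 Om \<sigma> J\<^sub>\<star> \<xi>\<close>. The equation then
    holds pointwise, and what remains to prove is that \<open>f\<close> is the image of
    \<open>\<xi>\<close>.\<close>
  define f where "f = pencil Om \<sigma> (\<lambda>x. - \<xi> x) h"
  have m\<xi>: "(\<lambda>x. - \<xi> x) \<in> Hsp U rho" using Hsp_diff[OF Hsp_zero \<xi>] by simp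
  have f: "f \<in> Hsp U rho" unfolding f_def by (rule pencil_Hsp[OF m\<xi> h])
  have J_minus: "Jstar (- u) = - Jstar u" for u by (simp add: Jstar_def vec_eq_iff)
  have csc_minus: "csc c (- u) = - csc c u" for c u by (simp add: csc_def vec_eq_iff)
  have weak: "Hinner U rho \<xi> (Aop rho s \<psi>) = Hinner U rho f \<psi>" if \<psi>: "\<psi> \<in> C0inf U" for \<psi>
  proof -
    note \<psi>H = C0inf_Hsp[OF \<psi>]
    have "(\<lambda>n. B (\<phi> n) \<psi> - l \<psi>) \<longlonglongrightarrow> 0"
    proof (rule Lim_null_comparison)
      show "\<forall>\<^sub>F n in sequentially. norm (B (\<phi> n) \<psi> - l \<psi>) \<le> inverse (real (Suc n)) * V.nrm \<psi>"
        using app[OF \<psi>] by (auto simp: inverse_eq_divide)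
      show "(\<lambda>n. inverse (real (Suc n)) * V.nrm \<psi>) \<longlonglongrightarrow> 0"
        by (rule tendsto_mult_left_zero[OF LIMSEQ_inverse_real_of_nat])
    qed
    then have "(\<lambda>n. B (\<phi> n) \<psi>) \<longlonglongrightarrow> l \<psi>" by (rule LIM_zero_cancel)
    then have "(\<lambda>n. B (\<phi> n) \<psi> / \<mu>) \<longlonglongrightarrow> l \<psi> / \<mu>" by (intro tendsto_intros \<mu>)
    then have lim1: "(\<lambda>n. pf (\<phi> n) \<psi>) \<longlonglongrightarrow> Hinner U rho h \<psi>" using \<mu> by (simp add: B_def l_def)
    have "(\<lambda>n. Hnorm U rho (\<lambda>x. Jstar (\<phi> n x) - Jstar (\<xi> x))) \<longlonglongrightarrow> 0"
    proof (rule Lim_null_comparison[OF _ lim], rule always_eventually, rule allI)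
      fix n
      have "(\<lambda>x. Jstar (\<phi> n x) - Jstar (\<xi> x)) = (\<lambda>x. Jstar (\<phi> n x - \<xi> x))"
        using Jstar_add[of _ "- _"] by (simp add: J_minus fun_eq_iff)
      then show "norm (Hnorm U rho (\<lambda>x. Jstar (\<phi> n x) - Jstar (\<xi> x))) \<le> Hnorm U rho (\<lambda>x. \<phi> n x - \<xi> x)"
        using Hnorm_Jstar_le[OF Hsp_diff[OF C0inf_Hsp[OF \<phi>] \<xi>]] Hnorm_nonneg by simp
    qed
    then have limJ: "(\<lambda>n. Hinner U rho (\<lambda>x. Jstar (\<phi> n x)) \<psi>) \<longlonglongrightarrow> Hinner U rho (\<lambda>x. Jstar (\<xi> x)) \<psi>"
      by (intro Hinner_tendsto_left Hsp_Jstar C0inf_Hsp \<phi> \<xi> \<psi>)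
    have limI: "(\<lambda>n. Hinner U rho (\<phi> n) u) \<longlonglongrightarrow> Hinner U rho \<xi> u" if "u \<in> Hsp U rho" for u
      by (intro Hinner_tendsto_left C0inf_Hsp \<phi> \<xi> lim that)
    \<comment> \<open>Moving the operator onto \<open>\<psi>\<close> makes every term an inner
      product with a fixed square integrable field, continuous under \<open>L^2\<close>
      convergence.\<close>
    have "(\<lambda>n. pf (\<phi> n) \<psi>) \<longlonglongrightarrow> - \<sigma>\<^sup>2 * Hinner U rho \<xi> \<psi>
        + 2 * Om * \<sigma> * Hinner U rho (\<lambda>x. Jstar (\<xi> x)) \<psi> + Hinner U rho \<xi> (Aop rho s \<psi>)"
      unfolding pf_def Hinner_Aop_right[OF \<phi> \<psi>, symmetric]
      by (intro tendsto_intros limJ limI \<psi>H Aop_Hsp \<psi>)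
    from LIMSEQ_unique[OF this lim1] have "Hinner U rho \<xi> (Aop rho s \<psi>) = Hinner U rho h \<psi>
        + \<sigma>\<^sup>2 * Hinner U rho \<xi> \<psi> - 2 * Om * \<sigma> * Hinner U rho (\<lambda>x. Jstar (\<xi> x)) \<psi>"
      by (simp add: algebra_simps)
    moreover have "Hinner U rho (\<lambda>x. - u x) \<psi> = - Hinner U rho u \<psi>" for u
      by (simp add: Hinner_def set_lebesgue_integral_def cinner_def sum_negf)
    then have "Hinner U rho f \<psi> = Hinner U rho h \<psi>
        + \<sigma>\<^sup>2 * Hinner U rho \<xi> \<psi> - 2 * Om * \<sigma> * Hinner U rho (\<lambda>x. Jstar (\<xi> x)) \<psi>"
      unfolding f_def Hinner_pencil[OF m\<xi> h \<psi>H] by (simp add: J_minus)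
    ultimately show ?thesis by simp
  qed
  have "Lgraph U rho s \<xi> f"
    unfolding Lgraph_def using \<open>\<xi> \<in> formdom U rho s\<close> f weak by blast
  moreover have "pencil Om \<sigma> \<xi> f = h"
    by (simp add: f_def pencil_def J_minus csc_minus)
  ultimately show ?thesis by (rule that)
qed

end

section \<open>The rotating gaseous star\<close>

text \<open>Away from the origin \<open>1 / norm x\<close> is a power of a positive polynomial, and
  only the square of \<open>varpi\<close> enters, so the rotation axis causes no
  singularity.\<close>

lemma ck_Ups:
  assumes "0 \<le> R0"
  shows "ck n {x. R0 < norm x} (Ups GM Om R)"
proof -
  let ?V = "{x::pt. R0 < norm x}"
  have V: "open ?V" by (intro open_Collect_less continuous_intros)
  have c: "ck n ?V (\<lambda>x::pt. x $ i)" for i by (rule ck_linear[OF bounded_linear_vec_nth V ck_ident[OF V]])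
  have nsq: "(norm x)\<^sup>2 = x$1 * x$1 + x$2 * x$2 + x$3 * x$3" for x :: pt
    by (simp add: norm_vec_def L2_set_def sum_nonneg sum_3 power2_eq_square)
  have pos: "0 < x$1 * x$1 + x$2 * x$2 + x$3 * x$3" if "x \<in> ?V" for x :: pt
    using that assms by (auto simp flip: nsq)
  have inv: "1 / norm x = (x$1 * x$1 + x$2 * x$2 + x$3 * x$3) powr (- 1 / 2)" if "x \<in> ?V" for x :: pt
  proof -
    have "norm x > 0" using that assms by auto
    then have "((norm x)\<^sup>2) powr (- 1 / 2) = norm x powr (- 1)"
      by (simp add: powr_powr flip: powr_numeral)
    then show ?thesis using \<open>norm x > 0\<close> by (simp add: nsq powr_minus_divide)
  qed
  have "ck n ?V (\<lambda>x. GM * ((x$1 * x$1 + x$2 * x$2 + x$3 * x$3) powr (- 1 / 2) + (- (1 / R)))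
      + Om\<^sup>2 / 2 * (x$1 * x$1 + x$2 * x$2))"
    by (intro ck_add[OF V] ck_mult[OF V] ck_const[OF V] ck_powr[OF V pos] c) auto
  then show ?thesis
  proof (rule ck_cong[OF V, rotated])
    fix x :: pt assume "x \<in> ?V"
    from inv[OF this] show "GM * ((x$1 * x$1 + x$2 * x$2 + x$3 * x$3) powr (- 1 / 2) + (- (1 / R)))
      + Om\<^sup>2 / 2 * (x$1 * x$1 + x$2 * x$2) = Ups GM Om R x"
      by (simp add: Ups_def varpi_def power2_eq_square)
  qed
qed

lemma open_region:
  assumes "0 \<le> R0"
  shows "open (region GM R0 Om R)"
proof -
  let ?V = "{x::pt. R0 < norm x}"
  have "open ?V" by (intro open_Collect_less continuous_intros)
  then have "open (?V \<inter> Ups GM Om R -` {0<..})"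
    by (intro continuous_open_preimage ck_continuous[OF ck_Ups[OF assms]]) auto
  moreover have "open {x. varpi x < 3 * R / 2}"
    unfolding varpi_def by (intro open_Collect_less continuous_intros)
  moreover have "region GM R0 Om R = (?V \<inter> Ups GM Om R -` {0<..}) \<inter> {x. varpi x < 3 * R / 2}"
    by (auto simp: region_def)
  ultimately show ?thesis by (simp add: open_Int)
qed

text \<open>Inside the region the bases of both powers are positive, so they are differentiable to
  every order whatever the exponent; at the boundary this may fail.\<close>

lemma acoustic_region_star:
  assumes "R0 \<ge> 0" "A > 0" "1 < g"
  shows "acoustic_region (region GM R0 Om R) (rhobar GM R0 A g Om R) (sbar GM R0 A g Om R)"
proof
  let ?U = "region GM R0 Om R" and ?r = "rhobar GM R0 A g Om R"
  let ?v = "\<lambda>x. (g - 1) / (A * g) * Ups GM Om R x"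
  show U: "open ?U" by (rule open_region[OF assms(1)])
  have v_pos: "0 < ?v x" if "x \<in> ?U" for x using that assms by (auto simp: region_def)
  have r: "?r x = ?v x powr (1 / (g - 1))" if "x \<in> ?U" for x using that by (simp add: rhobar_def)
  show r_pos: "0 < ?r x" if "x \<in> ?U" for x using v_pos[OF that] unfolding r[OF that] powr_gt_zero by linarith
  have "ck n ?U (Ups GM Om R)" for n
    by (rule ck_subset[OF ck_Ups[OF assms(1)]]) (auto simp: region_def)
  then have "ck n ?U (\<lambda>x. ?v x powr (1 / (g - 1)))" for n
    by (intro ck_powr[OF U v_pos] ck_mult[OF U] ck_const[OF U]) auto
  then have r_ck: "ck n ?U ?r" for n
    by (rule ck_cong[OF U, rotated]) (simp add: r)
  then show "ck 2 ?U ?r" .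
  have "ck 1 ?U (\<lambda>x. A * g * ?r x powr (g - 2))"
    by (intro ck_mult[OF U] ck_const[OF U] ck_powr[OF U r_pos] r_ck)
  then show "ck 1 ?U (sbar GM R0 A g Om R)"
    by (rule ck_cong[OF U, rotated]) (simp add: sbar_def)
  show "?r x = 0" if "x \<notin> ?U" for x using that by (simp add: rhobar_def)
  show "0 \<le> sbar GM R0 A g Om R x" for x using assms by (simp add: sbar_def)
qed

theorem theorem6:
  fixes GM R0 A g Om R :: real
  assumes "GM > 0" and "R0 > 0" and "A > 0" and "1 < g" and "g < 2"
    and "R0 < R" and "Om^2 * R^3 / (2 * GM) < 4 / 27"
  shows "pencil_spectrum GM R0 A g Om R \<subseteq> \<real>"
proof -
  let ?U = "region GM R0 Om R" and ?r = "rhobar GM R0 A g Om R" and ?s = "sbar GM R0 A g Om R"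
  interpret acoustic_region ?U ?r ?s using assms by (intro acoustic_region_star) auto
  \<comment> \<open>The exact pointwise solution serves as a solution almost everywhere, and the
    lower bound supplies a constant independent of the vector.\<close>
  have "\<sigma> \<in> pencil_resolvent GM R0 A g Om R" if \<sigma>: "Im \<sigma> \<noteq> 0" for \<sigma>
  proof -
    have "\<exists>\<xi> f. Lgraph ?U ?r ?s \<xi> f \<and> Heq ?U (pencil Om \<sigma> \<xi> f) h" if h: "h \<in> Hsp ?U ?r" for h
    proof -
      obtain \<xi> f where "Lgraph ?U ?r ?s \<xi> f" "pencil Om \<sigma> \<xi> f = h"
        using pencil_surjective[OF h \<sigma>, of Om] .
      then show ?thesis by (auto simp: Heq_def)
    qed
    moreover have "\<exists>C. \<forall>\<xi> f. Lgraph ?U ?r ?s \<xi> f \<longrightarrow> Hnorm ?U ?r \<xi> \<le> C * Hnorm ?U ?r (pencil Om \<sigma> \<xi> f)"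
      using pencil_lower_bound[OF _ \<sigma>] by blast
    ultimately show ?thesis unfolding pencil_resolvent_def Let_def pencil_def by blast
  qed
  then show ?thesis unfolding pencil_spectrum_def complex_is_Real_iff subset_iff by blast
qed

end
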